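(* Let $\beta>0$. The sequence of mm-spaces $\{\frac{1}{\sqrt n}C^n_\beta\}_{n=1}^\infty$ concentrates to the half line $([0,\infty),|\cdot|)$ equipped with the Borel probability measure $$\nu_\beta(dt)=\frac{2^{1-\frac\beta2}}{\Gamma(\frac\beta2)}\,\frac{1}{t^{\beta+1}}\,e^{-\frac{1}{2t^2}}\,dt .$$
   Context: **Cauchy space.** For $\beta>0$, $\nu^n_\beta$ is the Borel probability measure on $\mathbb{R}^n$ given by $$\nu^n_\beta(dx)=\frac{\Gamma(\frac{n+\beta}{2})}{\pi^{n/2}\Gamma(\frac\beta2)}\frac{dx}{(1+\|x\|^2)^{\frac{n+\beta}{2}}},$$ and $C^n_\beta:=(\mathbb{R}^n,\|\cdot\|,\nu^n_\beta)$ with the Euclidean distance. For an mm-space $X=(X,d_X,m_X)$ and $t>0$, $tX:=(X,t\,d_X,m_X)$. **mm-spaces and concentration.** An mm-space is a triple $X=(X,d_X,m_X)$ where $(X,d_X)$ is a complete separable metric space and $m_X$ is a Borel probability measure on $X$. Let $\mathcal{L}ip_1(X)$ be the set of real-valued $1$-Lipschitz functions on $X$. A parameter of $X$ is a Borel map $\varphi:[0,1]\to X$ with $\varphi_\#\mathcal{L}^1=m_X$. Put $\varphi^*\mathcal{L}ip_1(X)=\{f\circ\varphi: f\in\mathcal{L}ip_1(X)\}$. The Ky Fan metric on measurable functions on $[0,1]$ is $d_{KF}(g,h)=\inf\{\varepsilon\ge0:\mathcal{L}^1(|g-h|>\varepsilon)\le\varepsilon\}$. The observable distance is $d_{conc}(X,Y)=\inf_{\varphi,\psi}d_H(\varphi^*\mathcal{L}ip_1(X),\psi^*\mathcal{L}ip_1(Y))$,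 where $\varphi,\psi$ run over parameters of $X,Y$ and $d_H$ is the Hausdorff distance for $d_{KF}$. A sequence $X_n$ concentrates to $X$ if $d_{conc}(X_n,X)\to0$. *)

theory Defs
  imports "HOL-Probability.Probability"
begin

section \<open>Metric measure spaces\<close>

record 'a mm =
  mm_carrier :: "'a set"
  mm_dist :: "'a \<Rightarrow> 'a \<Rightarrow> real"
  mm_measure :: "'a measure"

definition mm_topology :: "'a mm \<Rightarrow> 'a topology" where
  "mm_topology X = Metric_space.mtopology (mm_carrier X) (mm_dist X)"

definition mm_space :: "'a mm \<Rightarrow> bool" where
  "mm_space X \<longleftrightarrow>
     Metric_space (mm_carrier X) (mm_dist X) \<and>
     Metric_space.mcomplete (mm_carrier X) (mm_dist X) \<and>
     separable_space (mm_topology X) \<and>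
     sets (mm_measure X) = sets (sigma (mm_carrier X) {U. openin (mm_topology X) U}) \<and>
     prob_space (mm_measure X)"

definition mm_scale :: "real \<Rightarrow> 'a mm \<Rightarrow> 'a mm" where
  "mm_scale t X = X\<lparr>mm_dist := (\<lambda>x y. t * mm_dist X x y)\<rparr>"

section \<open>Observable distance and concentration\<close>

abbreviation unit_lborel :: "real measure" where
  "unit_lborel \<equiv> restrict_space lborel {0..1}"

definition parameters :: "'a mm \<Rightarrow> (real \<Rightarrow> 'a) set" where
  "parameters X =
     {\<phi> \<in> unit_lborel \<rightarrow>\<^sub>M mm_measure X. distr unit_lborel (mm_measure X) \<phi> = mm_measure X}"

text \<open>Values of functions outside the carrier of \<open>X\<close>, and outside \<open>{0..1}\<close> for the
  functions compared by \<open>ky_fan\<close>, are unconstrained and play no role.\<close>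

definition Lip1 :: "'a mm \<Rightarrow> ('a \<Rightarrow> real) set" where
  "Lip1 X = {f. \<forall>x\<in>mm_carrier X. \<forall>y\<in>mm_carrier X. \<bar>f x - f y\<bar> \<le> mm_dist X x y}"

definition pullback_Lip1 :: "(real \<Rightarrow> 'a) \<Rightarrow> 'a mm \<Rightarrow> (real \<Rightarrow> real) set" where
  "pullback_Lip1 \<phi> X = (\<lambda>f. f \<circ> \<phi>) ` Lip1 X"

text \<open>The set under the infimum contains \<open>1\<close>, so the real infimum is the intended one.\<close>

definition ky_fan :: "(real \<Rightarrow> real) \<Rightarrow> (real \<Rightarrow> real) \<Rightarrow> real" where
  "ky_fan g h =
     Inf {\<epsilon>. 0 \<le> \<epsilon> \<and> measure unit_lborel {s \<in> {0..1}. \<bar>g s - h s\<bar> > \<epsilon>} \<le> \<epsilon>}"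

definition ky_fan_hausdorff :: "(real \<Rightarrow> real) set \<Rightarrow> (real \<Rightarrow> real) set \<Rightarrow> ennreal" where
  "ky_fan_hausdorff A B =
     max (SUP g\<in>A. INF h\<in>B. ennreal (ky_fan g h))
         (SUP h\<in>B. INF g\<in>A. ennreal (ky_fan g h))"

definition d_conc :: "'a mm \<Rightarrow> 'b mm \<Rightarrow> ennreal" where
  "d_conc X Y =
     (INF \<phi>\<in>parameters X. INF \<psi>\<in>parameters Y.
        ky_fan_hausdorff (pullback_Lip1 \<phi> X) (pullback_Lip1 \<psi> Y))"

definition concentrates_to :: "(nat \<Rightarrow> 'a mm) \<Rightarrow> 'b mm \<Rightarrow> bool" where
  "concentrates_to X Y \<longleftrightarrow>
     (\<forall>n. mm_space (X n)) \<and> mm_space Y \<and> (\<lambda>n. d_conc (X n) Y) \<longlonglongrightarrow> 0"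

section \<open>The Cauchy spaces and the limit space\<close>

text \<open>As \<open>n\<close> varies along the sequence, \<open>n\<close>-dimensional Euclidean space is represented by the
  functions on \<open>{..<n}\<close>, extended by \<open>undefined\<close>; the finite product of \<open>lborel\<close> is Lebesgue
  measure on it, and \<open>L2_set x {..<n}\<close> is the Euclidean norm of \<open>x\<close>.\<close>

definition cauchy_density :: "nat \<Rightarrow> real \<Rightarrow> (nat \<Rightarrow> real) \<Rightarrow> real" where
  "cauchy_density n \<beta> x =
     Gamma ((real n + \<beta>) / 2) / (pi powr (real n / 2) * Gamma (\<beta> / 2)) *
     (1 / (1 + (L2_set x {..<n})\<^sup>2) powr ((real n + \<beta>) / 2))"

definition cauchy_space :: "nat \<Rightarrow> real \<Rightarrow> (nat \<Rightarrow> real) mm" where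
  "cauchy_space n \<beta> =
     \<lparr>mm_carrier = {..<n} \<rightarrow>\<^sub>E UNIV,
      mm_dist = (\<lambda>x y. L2_set (\<lambda>i. x i - y i) {..<n}),
      mm_measure = density (\<Pi>\<^sub>M i\<in>{..<n}. lborel) (\<lambda>x. ennreal (cauchy_density n \<beta> x))\<rparr>"

text \<open>At \<open>t = 0\<close> the density below is \<open>0\<close> by totality of division; \<open>{0}\<close> is a null set.\<close>

definition half_line_density :: "real \<Rightarrow> real \<Rightarrow> real" where
  "half_line_density \<beta> t =
     2 powr (1 - \<beta> / 2) / Gamma (\<beta> / 2) * (1 / t powr (\<beta> + 1)) * exp (- 1 / (2 * t\<^sup>2))"

definition half_line_space :: "real \<Rightarrow> real mm" where
  "half_line_space \<beta> =
     \<lparr>mm_carrier = {0..},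
      mm_dist = (\<lambda>s t. \<bar>s - t\<bar>),
      mm_measure = density (restrict_space lborel {0..}) (\<lambda>t. ennreal (half_line_density \<beta> t))\<rparr>"

end

theory Submission
  imports Defs
begin

text \<open>If \<open>G\<close> is a standard Gaussian vector in \<open>\<real>\<^sup>n\<close> and \<open>T\<close> is independent of \<open>G\<close> with law \<open>\<nu>\<^sub>\<beta>\<close>, then
  \<open>T G\<close> has law \<open>\<nu>\<^sup>n\<^sub>\<beta>\<close>; this couples the Cauchy space with the half line. By the Prekopa-Leindler
  inequality a 1-Lipschitz function of \<open>G\<close> has variance at most 2, whatever the dimension. Hence, for
  1-Lipschitz \<open>f\<close>, \<open>f (T G / \<surd>n)\<close> is close in probability to \<open>h (T)\<close> where \<open>h (t)\<close> is the mean of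
  \<open>f (t G / \<surd>n)\<close>, and \<open>h\<close> is 1-Lipschitz because the mean of \<open>\<parallel>G\<parallel>\<close> is at most \<open>\<surd>n\<close>. Conversely a
  1-Lipschitz \<open>h\<close> on the half line is approximated by \<open>x \<mapsto> h \<parallel>x\<parallel>\<close>, as \<open>\<parallel>G\<parallel> / \<surd>n\<close> concentrates at 1.
  Both errors are bounded uniformly over the 1-Lipschitz functions.\<close>

section \<open>The Prekopa-Leindler inequality\<close>

text \<open>If \<open>T\<close> has law \<open>\<nu>\<^sub>\<beta>\<close>, then
  \<open>1 / T\<close> has the chi law with \<beta> degrees of freedom. The coupling is thus the
  usual description of a multivariate t law as a Gaussian vector divided by an independent chi
  variable, and the constant of the half-line density is that of the chi law. The density of
  \<open>T\<close> decays only like \<open>t powr (- \<beta> - 1)\<close>, so \<open>T^2\<close> has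
  infinite mean when \<beta> \<le> 2 and a mean square estimate of the whole error is out of reach.
  Chebyshev's inequality is therefore applied for each fixed value of \<open>T\<close>, its bound is
  capped at 1, and only then averaged over \<open>T\<close>. The observable distance asks for
  parameters on \<open>{0..1}\<close> that are fixed before any Lipschitz function is chosen. The
  product of the Gaussian space with the half line has to be the image of one Borel map from
  \<open>{0..1}\<close>; this map is a quantile function followed by a decoding of the digits of one
  real into all coordinates.\<close>

lemma emeasure_lborel_affine_vimage:
  fixes C :: "real set"
  assumes [measurable]: "C \<in> sets borel"
  shows "emeasure lborel {x. (x + b) / 2 \<in> C} = 2 * emeasure lborel C"
proof -
  have "emeasure lborel C = (\<integral>\<^sup>+x. indicator C x \<partial>lborel)"
    by simp
  also have "\<dots> = ennreal \<bar>1/2\<bar> * (\<integral>\<^sup>+x. indicator C (b/2 + 1/2 * x) \<partial>lborel)"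
    by (rule nn_integral_real_affine) auto
  also have "(\<integral>\<^sup>+x. indicator C (b/2 + 1/2 * x) \<partial>lborel) = (\<integral>\<^sup>+x. indicator {x. (x + b) / 2 \<in> C} x \<partial>lborel)"
    by (intro nn_integral_cong) (auto simp: indicator_def add_divide_distrib add.commute)
  also have "\<dots> = emeasure lborel {x. (x + b) / 2 \<in> C}"
    by (rule nn_integral_indicator) simp
  finally have *: "emeasure lborel C = ennreal (1/2) * emeasure lborel {x. (x + b) / 2 \<in> C}"
    by simp
  have "2 * (ennreal (1/2) * emeasure lborel {x. (x + b) / 2 \<in> C}) = ennreal (2 * (1/2)) * emeasure lborel {x. (x + b) / 2 \<in> C}"
    by (subst ennreal_mult'') (auto simp: mult.assoc)
  then show ?thesis using * by simp
qed

text \<open>For \<open>a\<close> near \<open>Sup A\<close> and \<open>b\<close> near \<open>Inf B\<close>, the midpoints of \<open>A \<inter> {..a}\<close> with \<open>b\<close> and those of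
  \<open>a\<close> with \<open>B \<inter> {b<..}\<close> lie in \<open>C\<close> on the two sides of \<open>(a + b) / 2\<close>.\<close>

lemma emeasure_lborel_midpoint_set:
  fixes A B C :: "real set"
  assumes [measurable]: "A \<in> sets borel" "B \<in> sets borel" "C \<in> sets borel"
    and ne: "A \<noteq> {}" "B \<noteq> {}" and bdd: "bdd_above A" "bdd_below B"
    and mid: "\<And>a b. a \<in> A \<Longrightarrow> b \<in> B \<Longrightarrow> (a + b) / 2 \<in> C"
  shows "emeasure lborel A + emeasure lborel B \<le> 2 * emeasure lborel C"
proof (rule ennreal_le_epsilon)
  fix e :: real assume "0 < e"
  define d where "d = e / 2"
  have "d > 0" using \<open>0 < e\<close> by (simp add: d_def)
  obtain a where a: "a \<in> A" "Sup A - d < a"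
    using less_cSupE[of "Sup A - d" A] ne \<open>d > 0\<close> by auto
  obtain b where b: "b \<in> B" "b < Inf B + d"
    using cInf_lessD[of B "Inf B + d"] ne \<open>d > 0\<close> by auto
  define c where "c = (a + b) / 2"
  have "emeasure lborel A \<le> emeasure lborel ((A \<inter> {..a}) \<union> {a<..Sup A})"
    using cSup_upper[OF _ bdd(1)] by (intro emeasure_mono) auto
  also have "\<dots> \<le> emeasure lborel (A \<inter> {..a}) + emeasure lborel {a<..Sup A}"
    by (intro emeasure_subadditive) auto
  also have "emeasure lborel {a<..Sup A} \<le> ennreal d"
    using a cSup_upper[OF a(1) bdd(1)] by (simp add: ennreal_leI)
  also have "emeasure lborel (A \<inter> {..a}) \<le> emeasure lborel {x. (x + b) / 2 \<in> C \<inter> {..c}}"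
    using mid b by (intro emeasure_mono) (auto simp: c_def)
  also have "\<dots> = 2 * emeasure lborel (C \<inter> {..c})"
    by (rule emeasure_lborel_affine_vimage) auto
  finally have A: "emeasure lborel A \<le> 2 * emeasure lborel (C \<inter> {..c}) + ennreal d"
    by (simp add: add_right_mono)
  have "emeasure lborel B \<le> emeasure lborel ({b<..} \<inter> B \<union> {Inf B..b})"
    using cInf_lower[OF _ bdd(2)] by (intro emeasure_mono) auto
  also have "\<dots> \<le> emeasure lborel ({b<..} \<inter> B) + emeasure lborel {Inf B..b}"
    by (intro emeasure_subadditive) auto
  also have "emeasure lborel {Inf B..b} \<le> ennreal d"
    using b cInf_lower[OF b(1) bdd(2)] by (simp add: ennreal_leI)
  also have "emeasure lborel ({b<..} \<inter> B) \<le> emeasure lborel {x. (x + a) / 2 \<in> C \<inter> {c<..}}"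
    using mid[OF a(1)] by (intro emeasure_mono) (auto simp: c_def add.commute)
  also have "\<dots> = 2 * emeasure lborel (C \<inter> {c<..})"
    by (rule emeasure_lborel_affine_vimage) auto
  finally have B: "emeasure lborel B \<le> 2 * emeasure lborel (C \<inter> {c<..}) + ennreal d"
    by (simp add: add_right_mono)
  have C: "emeasure lborel C = emeasure lborel (C \<inter> {..c}) + emeasure lborel (C \<inter> {c<..})"
    by (subst plus_emeasure) (auto intro!: arg_cong[where f="emeasure lborel"])
  have "emeasure lborel A + emeasure lborel B \<le>
     (2 * emeasure lborel (C \<inter> {..c}) + ennreal d) + (2 * emeasure lborel (C \<inter> {c<..}) + ennreal d)"
    using A B by (rule add_mono)
  also have "\<dots> = 2 * emeasure lborel C + (ennreal d + ennreal d)"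
    by (simp add: C algebra_simps)
  also have "ennreal d + ennreal d = ennreal e"
    using \<open>d > 0\<close> by (subst ennreal_plus[symmetric]) (auto simp: d_def)
  finally show "emeasure lborel A + emeasure lborel B \<le> 2 * emeasure lborel C + ennreal e" .
qed

text \<open>Tonelli for the set of pairs \<open>(x, l)\<close> with \<open>0 < l < 1\<close> and
  \<open>l < f x\<close>. The cap at 1 keeps only the levels at which the superlevel sets of
  functions with supremum 1 are nonempty, as the midpoint inequality for sets requires.\<close>

lemma nn_integral_min_1_level_sets:
  fixes f :: "real \<Rightarrow> ennreal"
  assumes [measurable]: "f \<in> borel_measurable borel"
  shows "(\<integral>\<^sup>+x. min 1 (f x) \<partial>lborel) =
    (\<integral>\<^sup>+l. indicator {0<..<1} l * emeasure lborel {x. ennreal l < f x} \<partial>lborel)"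
proof -
  interpret lborel_pair: pair_sigma_finite "lborel :: real measure" "lborel :: real measure" ..
  have m: "(\<lambda>(x, l). indicator {0<..<1::real} l * indicator {x. ennreal l < f x} x :: ennreal)
      \<in> borel_measurable (lborel \<Otimes>\<^sub>M lborel)"
  proof -
    have "(\<lambda>(x, l). indicator {0<..<1::real} l * (if ennreal l < f x then 1 else 0 :: ennreal))
        \<in> borel_measurable (lborel \<Otimes>\<^sub>M lborel)"
      by measurable
    also have "(\<lambda>(x, l). indicator {0<..<1::real} l * (if ennreal l < f x then 1 else 0 :: ennreal)) =
        (\<lambda>(x, l). indicator {0<..<1::real} l * indicator {x. ennreal l < f x} x)"
      by (auto simp: fun_eq_iff indicator_def)
    finally show ?thesis .
  qed
  have *: "(\<integral>\<^sup>+l. indicator {0<..<1::real} l * indicator {x. ennreal l < f x} x \<partial>lborel) = min 1 (f x)" for x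
  proof -
    obtain r where r: "min 1 (f x) = ennreal r" "0 \<le> r"
      by (cases "min 1 (f x)") (auto simp: min_def split: if_splits)
    have le: "0 < l \<and> l < 1 \<and> ennreal l < f x \<longleftrightarrow> 0 < l \<and> l < r" for l :: real
    proof (cases "0 < l")
      case True
      have "l < r \<longleftrightarrow> ennreal l < min 1 (f x)"
        using True r by (simp add: ennreal_less_iff)
      also have "\<dots> \<longleftrightarrow> l < 1 \<and> ennreal l < f x"
        using True by (simp add: min_less_iff_conj)
      finally show ?thesis using True by simp
    qed auto
    have "(\<integral>\<^sup>+l. indicator {0<..<1::real} l * indicator {x. ennreal l < f x} x \<partial>lborel) =
      (\<integral>\<^sup>+l. indicator {0<..<r} l \<partial>lborel)"
      using le by (intro nn_integral_cong) (auto simp: indicator_def)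
    also have "\<dots> = ennreal r" using r by simp
    finally show ?thesis using r by simp
  qed
  have "(\<integral>\<^sup>+x. min 1 (f x) \<partial>lborel) =
    (\<integral>\<^sup>+x. \<integral>\<^sup>+l. indicator {0<..<1} l * indicator {x. ennreal l < f x} x \<partial>lborel \<partial>lborel)"
    by (simp add: *)
  also have "\<dots> = (\<integral>\<^sup>+l. \<integral>\<^sup>+x. indicator {0<..<1} l * indicator {x. ennreal l < f x} x \<partial>lborel \<partial>lborel)"
    by (rule lborel_pair.Fubini'[OF m, symmetric])
  also have "\<dots> = (\<integral>\<^sup>+l. indicator {0<..<1} l * emeasure lborel {x. ennreal l < f x} \<partial>lborel)"
    by (intro nn_integral_cong) (subst nn_integral_cmult, auto)
  finally show ?thesis .
qed

lemma ennreal_amgm: "4 * (a * b) \<le> (a + b)^2" for a b :: ennreal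
proof (cases "a = \<top> \<or> b = \<top>")
  case True then show ?thesis by (auto simp: power2_eq_square ennreal_top_mult ennreal_mult_top)
next
  case False
  then obtain r s where rs: "a = ennreal r" "0 \<le> r" "b = ennreal s" "0 \<le> s"
    by (metis ennreal_cases)
  have "4 * (r * s) \<le> (r + s)^2"
    using zero_le_power2[of "r - s"] by (simp add: power2_eq_square algebra_simps)
  then have "ennreal (4 * (r * s)) \<le> ennreal ((r + s)^2)"
    by (rule ennreal_leI)
  then show ?thesis
    using rs by (simp add: ennreal_mult ennreal_power[symmetric])
qed

text \<open>For \<open>0 < l < 1\<close> the superlevel sets satisfy the midpoint inequality for
  sets. Integrating over \<open>l\<close> gives the additive bound
  \<open>\<integral>f + \<integral>g \<le> 2 * \<integral>h\<close>, and the arithmetic-geometric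
  mean inequality turns it into the product bound. Equal suprema matter: at a level where only one
  of the two superlevel sets is nonempty, the inequality for sets does not apply.\<close>

lemma prekopa_leindler_midpoint_normalized:
  fixes f g h :: "real \<Rightarrow> ennreal"
  assumes [measurable]: "f \<in> borel_measurable borel" "g \<in> borel_measurable borel" "h \<in> borel_measurable borel"
    and supp: "\<And>x. K < \<bar>x\<bar> \<Longrightarrow> f x = 0" "\<And>x. K < \<bar>x\<bar> \<Longrightarrow> g x = 0"
    and sup: "(SUP x. f x) = 1" "(SUP x. g x) = 1"
    and fgh: "\<And>x y. f x * g y \<le> (h ((x + y) / 2))^2"
  shows "integral\<^sup>N lborel f * integral\<^sup>N lborel g \<le> (integral\<^sup>N lborel h)^2"
proof -
  define F G H where "F l = {x. ennreal l < f x}" and "G l = {x. ennreal l < g x}"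
    and "H l = {x. ennreal l < h x}" for l
  have [measurable]: "F l \<in> sets borel" "G l \<in> sets borel" "H l \<in> sets borel" for l
    by (auto simp: F_def G_def H_def)
  have le1: "f x \<le> 1" "g x \<le> 1" for x
    using sup by (metis SUP_upper UNIV_I)+
  have "emeasure lborel (F l) + emeasure lborel (G l) \<le> 2 * emeasure lborel (H l)" if l: "0 < l" "l < 1" for l
  proof (rule emeasure_lborel_midpoint_set)
    have "ennreal l < (SUP x. f x)" "ennreal l < (SUP x. g x)"
      using l by (auto simp: sup ennreal_less_one_iff)
    then show "F l \<noteq> {}" "G l \<noteq> {}"
      by (auto simp: less_SUP_iff F_def G_def)
    have "x \<in> {-K..K}" if "x \<in> F l \<or> x \<in> G l" for x
      using supp[of x] that by (cases "K < \<bar>x\<bar>") (auto simp: F_def G_def)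
    then have "F l \<subseteq> {-K..K}" "G l \<subseteq> {-K..K}" by auto
    then show "bdd_above (F l)" "bdd_below (G l)"
      by (meson bdd_above_mono bdd_above_Icc bdd_below_mono bdd_below_Icc)+
    fix x y assume "x \<in> F l" "y \<in> G l"
    then have "ennreal l < f x" "ennreal l < g y" by (auto simp: F_def G_def)
    then obtain p q where p: "ennreal l < ennreal p" "ennreal p \<le> f x" "0 \<le> p"
        and q: "ennreal l < ennreal q" "ennreal q \<le> g y" "0 \<le> q"
      by (metis ennreal_cases dense less_imp_le top.not_eq_extremum top.extremum_strict not_less_iff_gr_or_eq)
    have "l * l < p * q"
      using p q l by (intro mult_strict_mono) (auto simp: ennreal_less_iff)
    then have "ennreal l * ennreal l < ennreal p * ennreal q"
      using p q l by (simp add: ennreal_mult[symmetric] ennreal_less_iff)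
    also have "\<dots> \<le> f x * g y"
      by (intro mult_mono p q) auto
    also have "\<dots> \<le> (h ((x + y) / 2))^2" by (rule fgh)
    finally have "ennreal l * ennreal l < (h ((x + y) / 2))^2" .
    then have "ennreal l < h ((x + y) / 2)"
      using mult_mono[of "h ((x + y) / 2)" "ennreal l" "h ((x + y) / 2)" "ennreal l"]
      by (force simp: power2_eq_square not_less)
    then show "(x + y) / 2 \<in> H l" by (simp add: H_def)
  qed auto
  then have "indicator {0<..<1} l * emeasure lborel (F l) + indicator {0<..<1} l * emeasure lborel (G l)
      \<le> 2 * (indicator {0<..<1} l * emeasure lborel (H l))" for l
    by (auto simp: indicator_def)
  then have "(\<integral>\<^sup>+l. indicator {0<..<1} l * emeasure lborel (F l) + indicator {0<..<1} l * emeasure lborel (G l) \<partial>lborel)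
      \<le> (\<integral>\<^sup>+l. 2 * (indicator {0<..<1} l * emeasure lborel (H l)) \<partial>lborel)"
    by (intro nn_integral_mono)
  moreover have [measurable]: "(\<lambda>l. emeasure lborel (F l)) \<in> borel_measurable borel"
     "(\<lambda>l. emeasure lborel (G l)) \<in> borel_measurable borel" "(\<lambda>l. emeasure lborel (H l)) \<in> borel_measurable borel"
    unfolding F_def G_def H_def by measurable
  ultimately have "(\<integral>\<^sup>+x. min 1 (f x) \<partial>lborel) + (\<integral>\<^sup>+x. min 1 (g x) \<partial>lborel) \<le> 2 * (\<integral>\<^sup>+x. min 1 (h x) \<partial>lborel)"
    by (simp add: nn_integral_min_1_level_sets nn_integral_add nn_integral_cmult F_def[symmetric] G_def[symmetric] H_def[symmetric])
  also have "\<dots> \<le> 2 * integral\<^sup>N lborel h"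
    by (intro mult_left_mono nn_integral_mono) auto
  finally have *: "integral\<^sup>N lborel f + integral\<^sup>N lborel g \<le> 2 * integral\<^sup>N lborel h"
    by (simp add: min_absorb2 le1)
  have "4 * (integral\<^sup>N lborel f * integral\<^sup>N lborel g) \<le> (2 * integral\<^sup>N lborel h)^2"
    using ennreal_amgm power_mono[OF *, of 2] by (rule order_trans) simp
  also have "\<dots> = 4 * (integral\<^sup>N lborel h)^2"
    by (simp add: power_mult_distrib)
  finally show ?thesis
    by (simp add: ennreal_mult_le_mult_iff)
qed

text \<open>Hypothesis and conclusion are invariant under scaling \<open>f\<close> by
  \<open>1/a\<close>, \<open>g\<close> by \<open>1/b\<close> and \<open>h\<close> by
  \<open>1 / sqrt (a * b)\<close>, which reduces the claim to suprema equal to 1. The bound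
  \<open>k\<close> makes the suprema \<open>a\<close> and \<open>b\<close> finite; a vanishing
  supremum is the trivial case.\<close>

lemma prekopa_leindler_midpoint_bounded:
  fixes f g h :: "real \<Rightarrow> ennreal"
  assumes [measurable]: "f \<in> borel_measurable borel" "g \<in> borel_measurable borel" "h \<in> borel_measurable borel"
    and supp: "\<And>x. K < \<bar>x\<bar> \<Longrightarrow> f x = 0" "\<And>x. K < \<bar>x\<bar> \<Longrightarrow> g x = 0"
    and bdd: "\<And>x. f x \<le> of_nat k" "\<And>x. g x \<le> of_nat k"
    and fgh: "\<And>x y. f x * g y \<le> (h ((x + y) / 2))^2"
  shows "integral\<^sup>N lborel f * integral\<^sup>N lborel g \<le> (integral\<^sup>N lborel h)^2"
proof (cases "(SUP x. f x) = 0 \<or> (SUP x. g x) = 0")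
  case True
  then have "(\<forall>x. f x = 0) \<or> (\<forall>x. g x = 0)"
    by (metis SUP_upper UNIV_I le_zero_eq)
  then have "integral\<^sup>N lborel f = 0 \<or> integral\<^sup>N lborel g = 0"
    by (simp add: nn_integral_0_iff_AE) (elim disjE; simp)
  then show ?thesis by auto
next
  case False
  have "(SUP x. f x) \<le> of_nat k" "(SUP x. g x) \<le> of_nat k"
    using bdd by (auto intro: SUP_least)
  then have "(SUP x. f x) < \<top>" "(SUP x. g x) < \<top>"
    by (meson le_less_trans of_nat_less_top)+
  then obtain a b where a: "(SUP x. f x) = ennreal a" "0 \<le> a" and b: "(SUP x. g x) = ennreal b" "0 \<le> b"
    by (metis ennreal_cases less_irrefl)
  with False have ab: "0 < a" "0 < b" by (auto simp: less_le)
  define c where "c = sqrt (a * b)"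
  have c: "0 < c" "c * c = a * b" using ab by (auto simp: c_def)
  have "(\<integral>\<^sup>+x. ennreal (1/a) * f x \<partial>lborel) * (\<integral>\<^sup>+x. ennreal (1/b) * g x \<partial>lborel) \<le> (\<integral>\<^sup>+x. ennreal (1/c) * h x \<partial>lborel)^2"
  proof (rule prekopa_leindler_midpoint_normalized[where K=K])
    show "(SUP x. ennreal (1/a) * f x) = 1" "(SUP x. ennreal (1/b) * g x) = 1"
      using ab by (auto simp: SUP_mult_left_ennreal[symmetric] a b ennreal_mult[symmetric])
    fix x y
    have "ennreal (1/a) * f x * (ennreal (1/b) * g y) = ennreal (1/a) * ennreal (1/b) * (f x * g y)"
      by (simp add: mult_ac)
    also have "ennreal (1/a) * ennreal (1/b) = ennreal (1/c) * ennreal (1/c)"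
      using ab c by (simp add: ennreal_mult[symmetric])
    also have "\<dots> * (f x * g y) \<le> ennreal (1/c) * ennreal (1/c) * (h ((x + y) / 2))^2"
      by (intro mult_left_mono fgh) auto
    finally show "ennreal (1/a) * f x * (ennreal (1/b) * g y) \<le> (ennreal (1/c) * h ((x + y) / 2))^2"
      by (simp add: power2_eq_square mult_ac)
  qed (auto simp: supp)
  then have "ennreal (1/a) * ennreal (1/b) * (integral\<^sup>N lborel f * integral\<^sup>N lborel g) \<le>
     ennreal (1/c) * ennreal (1/c) * (integral\<^sup>N lborel h)^2"
    by (simp add: nn_integral_cmult power2_eq_square) (simp add: mult_ac)
  also have "ennreal (1/c) * ennreal (1/c) = ennreal (1/a) * ennreal (1/b)"
    using ab c by (simp add: ennreal_mult[symmetric])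
  finally show ?thesis
    using ab by (simp add: ennreal_mult[symmetric] ennreal_mult_le_mult_iff)
qed

text \<open>Cutting \<open>f\<close> and \<open>g\<close> off at \<open>k\<close>, in height and in
  support, only decreases the left side of the hypothesis, so the same \<open>h\<close> still works.
  Monotone convergence removes the cutoff.\<close>

lemma prekopa_leindler_midpoint_real:
  fixes f g h :: "real \<Rightarrow> ennreal"
  assumes [measurable]: "f \<in> borel_measurable borel" "g \<in> borel_measurable borel" "h \<in> borel_measurable borel"
    and fgh: "\<And>x y. f x * g y \<le> (h ((x + y) / 2))^2"
  shows "integral\<^sup>N lborel f * integral\<^sup>N lborel g \<le> (integral\<^sup>N lborel h)^2"
proof -
  define tr :: "(real \<Rightarrow> ennreal) \<Rightarrow> nat \<Rightarrow> real \<Rightarrow> ennreal"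
    where "tr f k x = (if \<bar>x\<bar> \<le> real k then min (of_nat k) (f x) else 0)" for f k x
  have [measurable]: "tr u k \<in> borel_measurable borel" if [measurable]: "u \<in> borel_measurable borel" for u k
    unfolding tr_def by measurable
  have tr_le: "tr u k x \<le> u x" for u k x by (auto simp: tr_def)
  have inc: "incseq (tr u)" for u
  proof (intro incseq_SucI le_funI)
    fix k x show "tr u k x \<le> tr u (Suc k) x"
    proof -
      have "min (of_nat k) (u x) \<le> min (of_nat (Suc k)) (u x)"
        by (intro min.mono order.refl of_nat_mono) simp
      then show ?thesis by (simp add: tr_def)
    qed
  qed
  have sup: "(SUP k. tr u k x) = u x" for u x
  proof (rule antisym)
    show "(SUP k. tr u k x) \<le> u x" using tr_le by (auto intro: SUP_least)
    show "u x \<le> (SUP k. tr u k x)"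
    proof (rule le_SUP_iff[THEN iffD2, rule_format])
      fix y assume y: "y < u x"
      then obtain r where r: "y = ennreal r" "0 \<le> r"
        by (metis ennreal_cases less_irrefl not_less_iff_gr_or_eq top.not_eq_extremum top.extremum_strict)
      obtain k where k: "max r \<bar>x\<bar> < real k" using reals_Archimedean2 by blast
      have "y < of_nat k"
        using r k by (simp add: ennreal_of_nat_eq_real_of_nat ennreal_less_iff)
      then have "y < tr u k x" using y k by (auto simp: tr_def)
      then show "\<exists>i\<in>UNIV. y < tr u i x" by blast
    qed
  qed
  have conv: "integral\<^sup>N lborel u = (SUP k. integral\<^sup>N lborel (tr u k))"
    if [measurable]: "u \<in> borel_measurable borel" for u
  proof -
    have "integral\<^sup>N lborel u = (\<integral>\<^sup>+x. (SUP k. tr u k x) \<partial>lborel)" by (simp add: sup)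
    also have "\<dots> = (SUP k. integral\<^sup>N lborel (tr u k))"
      by (rule nn_integral_monotone_convergence_SUP[OF inc]) auto
    finally show ?thesis .
  qed
  have mono: "integral\<^sup>N lborel (tr u i) \<le> integral\<^sup>N lborel (tr u j)" if "i \<le> j" for u i j
    using incseqD[OF inc that] by (intro nn_integral_mono) (auto simp: le_fun_def)
  \<comment> \<open>A product of two suprema ranges over independent indices \<open>i\<close> and
    \<open>j\<close>; by monotonicity both may be raised to \<open>max i j\<close>.\<close>
  have "integral\<^sup>N lborel (tr f i) * integral\<^sup>N lborel (tr g j) \<le> (integral\<^sup>N lborel h)^2" for i j
  proof -
    have "integral\<^sup>N lborel (tr f i) * integral\<^sup>N lborel (tr g j) \<le>
      integral\<^sup>N lborel (tr f (max i j)) * integral\<^sup>N lborel (tr g (max i j))"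
      by (intro mult_mono mono) auto
    also have "\<dots> \<le> (integral\<^sup>N lborel h)^2"
    proof (rule prekopa_leindler_midpoint_bounded[where K="real (max i j)" and k="max i j"])
      fix x y show "tr f (max i j) x * tr g (max i j) y \<le> (h ((x + y) / 2))^2"
        using mult_mono[OF tr_le tr_le] fgh by (meson order_trans zero_le)
    qed (auto simp: tr_def)
    finally show ?thesis .
  qed
  then show ?thesis
    unfolding conv[OF assms(1)] conv[OF assms(2)]
    by (auto simp: SUP_mult_left_ennreal SUP_mult_right_ennreal intro!: SUP_least)
qed

text \<open>Induction on the dimension. For values \<open>s\<close> and \<open>t\<close> of the new
  coordinate, the fibres of \<open>f\<close> at \<open>s\<close>, of \<open>g\<close> at
  \<open>t\<close> and of \<open>h\<close> at the midpoint satisfy the hypothesis in one dimension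
  less. Hence the fibre integrals, as functions of the new coordinate, satisfy the hypothesis of the
  inequality on the line.\<close>

theorem prekopa_leindler_midpoint:
  fixes f g h :: "('i \<Rightarrow> real) \<Rightarrow> ennreal"
  assumes "finite I"
    and "f \<in> borel_measurable (PiM I (\<lambda>_. lborel))" "g \<in> borel_measurable (PiM I (\<lambda>_. lborel))"
      "h \<in> borel_measurable (PiM I (\<lambda>_. lborel))"
    and "\<And>x y. x \<in> I \<rightarrow>\<^sub>E UNIV \<Longrightarrow> y \<in> I \<rightarrow>\<^sub>E UNIV \<Longrightarrow> f x * g y \<le> (h (\<lambda>i\<in>I. (x i + y i) / 2))^2"
  shows "integral\<^sup>N (PiM I (\<lambda>_. lborel)) f * integral\<^sup>N (PiM I (\<lambda>_. lborel)) g \<le> (integral\<^sup>N (PiM I (\<lambda>_. lborel)) h)^2"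
  using assms
proof (induction I arbitrary: f g h rule: finite_induct)
  case empty
  interpret product_sigma_finite "\<lambda>_::'i. lborel :: real measure" ..
  show ?case using empty.prems(4)[of "\<lambda>_. undefined" "\<lambda>_. undefined"] by (simp add: nn_integral_empty)
next
  case (insert i I)
  interpret product_sigma_finite "\<lambda>_::'i. lborel :: real measure" ..
  interpret I: finite_product_sigma_finite "\<lambda>_::'i. lborel :: real measure" I by standard fact
  note [measurable] = insert.prems(1-3)
  let ?M = "PiM I (\<lambda>_::'i. lborel :: real measure)"
  have [measurable]: "(\<lambda>y. \<integral>\<^sup>+x. u (x(i := y)) \<partial>?M) \<in> borel_measurable borel"
    if [measurable]: "u \<in> borel_measurable (PiM (insert i I) (\<lambda>_. lborel))" for u :: "('i \<Rightarrow> real) \<Rightarrow> ennreal"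
    by measurable
  have [measurable]: "(\<lambda>x. u (x(i := y))) \<in> borel_measurable ?M"
    if [measurable]: "u \<in> borel_measurable (PiM (insert i I) (\<lambda>_. lborel))" for u :: "('i \<Rightarrow> real) \<Rightarrow> ennreal" and y
    by measurable
  have "(\<integral>\<^sup>+t. \<integral>\<^sup>+x. f (x(i := t)) \<partial>?M \<partial>lborel) * (\<integral>\<^sup>+t. \<integral>\<^sup>+x. g (x(i := t)) \<partial>?M \<partial>lborel)
    \<le> (\<integral>\<^sup>+t. \<integral>\<^sup>+x. h (x(i := t)) \<partial>?M \<partial>lborel)^2"
  proof (rule prekopa_leindler_midpoint_real)
    fix s t :: real
    show "(\<integral>\<^sup>+x. f (x(i := s)) \<partial>?M) * (\<integral>\<^sup>+x. g (x(i := t)) \<partial>?M) \<le> (\<integral>\<^sup>+x. h (x(i := (s + t) / 2)) \<partial>?M)\<^sup>2"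
    proof (rule insert.IH)
      fix x y :: "'i \<Rightarrow> real" assume xy: "x \<in> I \<rightarrow>\<^sub>E UNIV" "y \<in> I \<rightarrow>\<^sub>E UNIV"
      have "f (x(i := s)) * g (y(i := t)) \<le> (h (\<lambda>j\<in>insert i I. ((x(i := s)) j + (y(i := t)) j) / 2))\<^sup>2"
        using xy by (intro insert.prems(4)) (auto simp: PiE_iff extensional_def)
      also have "(\<lambda>j\<in>insert i I. ((x(i := s)) j + (y(i := t)) j) / 2) = (\<lambda>j\<in>I. (x j + y j) / 2)(i := (s + t) / 2)"
        using \<open>i \<notin> I\<close> by (auto simp: fun_eq_iff)
      finally show "f (x(i := s)) * g (y(i := t)) \<le> (h ((\<lambda>j\<in>I. (x j + y j) / 2)(i := (s + t) / 2)))\<^sup>2" .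
    qed measurable
  qed measurable
  then show ?case
    using insert.hyps insert.prems(1-3) by (simp add: product_nn_integral_insert_rev)
qed

section \<open>Gaussian concentration\<close>

definition gauss :: "nat \<Rightarrow> (nat \<Rightarrow> real) measure" where
  "gauss n = (\<Pi>\<^sub>M i\<in>{..<n}. density lborel (\<lambda>x. ennreal (std_normal_density x)))"

lemma sets_gauss [measurable_cong]: "sets (gauss n) = sets (\<Pi>\<^sub>M i\<in>{..<n}. lborel)"
  by (auto simp: gauss_def intro!: sets_PiM_cong)

lemma space_gauss: "space (gauss n) = {..<n} \<rightarrow>\<^sub>E UNIV"
  by (simp add: gauss_def space_PiM)

lemma prob_space_gauss: "prob_space (gauss n)"
  unfolding gauss_def by (intro prob_space_PiM prob_space_normal_density) simp

lemma PiM_density_lborel: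
  fixes p :: "real \<Rightarrow> real"
  assumes [measurable]: "p \<in> borel_measurable borel" and nonneg: "\<And>x. 0 \<le> p x"
    and prob: "prob_space (density lborel (\<lambda>x. ennreal (p x)))" and fin: "finite I"
  shows "PiM I (\<lambda>_. density lborel (\<lambda>x. ennreal (p x))) =
    density (PiM I (\<lambda>_. lborel)) (\<lambda>x. ennreal (\<Prod>i\<in>I. p (x i)))"
proof -
  interpret product_sigma_finite "\<lambda>_::'a. lborel :: real measure" ..
  interpret N: product_prob_space "\<lambda>_::'a. density lborel (\<lambda>x. ennreal (p x))"
    using prob by (auto simp: product_prob_space_def product_prob_space_axioms_def product_sigma_finite_def
      intro!: prob_space_imp_sigma_finite)
  show ?thesis
  proof (rule N.PiM_eqI[OF fin, symmetric])
    show "sets (density (PiM I (\<lambda>_. lborel)) (\<lambda>x. ennreal (\<Prod>i\<in>I. p (x i)))) =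
        sets (PiM I (\<lambda>_. density lborel (\<lambda>x. ennreal (p x))))"
      by (auto intro!: sets_PiM_cong)
    fix A assume "\<And>i. i \<in> I \<Longrightarrow> A i \<in> sets (density lborel (\<lambda>x. ennreal (p x)))"
    then have [measurable]: "\<And>i. i \<in> I \<Longrightarrow> A i \<in> sets borel" by simp
    have "emeasure (density (PiM I (\<lambda>_. lborel)) (\<lambda>x. ennreal (\<Prod>i\<in>I. p (x i)))) (Pi\<^sub>E I A) =
        (\<integral>\<^sup>+x. ennreal (\<Prod>i\<in>I. p (x i)) * indicator (Pi\<^sub>E I A) x \<partial>PiM I (\<lambda>_. lborel))"
      using fin by (intro emeasure_density) (auto intro!: sets_PiM_I_finite)
    also have "\<dots> = (\<integral>\<^sup>+x. (\<Prod>i\<in>I. ennreal (p (x i)) * indicator (A i) (x i)) \<partial>PiM I (\<lambda>_. lborel))"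
    proof (rule nn_integral_cong)
      fix x assume "x \<in> space (PiM I (\<lambda>_. lborel :: real measure))"
      then have "indicator (Pi\<^sub>E I A) x = (\<Prod>i\<in>I. indicator (A i) (x i) :: ennreal)"
        using fin by (auto simp: indicator_def space_PiM PiE_iff prod.neutral)
      then show "ennreal (\<Prod>i\<in>I. p (x i)) * indicator (Pi\<^sub>E I A) x = (\<Prod>i\<in>I. ennreal (p (x i)) * indicator (A i) (x i))"
        by (simp add: prod.distrib prod_ennreal nonneg)
    qed
    also have "\<dots> = (\<Prod>i\<in>I. \<integral>\<^sup>+x. ennreal (p x) * indicator (A i) x \<partial>lborel)"
      by (intro product_nn_integral_prod fin) measurable
    also have "\<dots> = (\<Prod>i\<in>I. emeasure (density lborel (\<lambda>x. ennreal (p x))) (A i))"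
      by (intro prod.cong refl) (simp add: emeasure_density)
    finally show "emeasure (density (PiM I (\<lambda>_. lborel)) (\<lambda>x. ennreal (\<Prod>i\<in>I. p (x i)))) (Pi\<^sub>E I A) =
      (\<Prod>i\<in>I. emeasure (density lborel (\<lambda>x. ennreal (p x))) (A i))" .
  qed
qed

lemma gauss_density:
  "gauss n = density (\<Pi>\<^sub>M i\<in>{..<n}. lborel) (\<lambda>x. ennreal (\<Prod>i<n. std_normal_density (x i)))"
  unfolding gauss_def by (rule PiM_density_lborel) (auto simp: prob_space_normal_density)

text \<open>With \<open>t\<close> a value of \<open>T\<close>, this is the conditional density of
  \<open>T G\<close> given \<open>T = t\<close>.\<close>

lemma scale_gauss:
  assumes t: "0 < t"
  shows "distr (gauss n) (\<Pi>\<^sub>M i\<in>{..<n}. lborel) (\<lambda>x. \<lambda>i\<in>{..<n}. t * x i) =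
    density (\<Pi>\<^sub>M i\<in>{..<n}. lborel) (\<lambda>x. ennreal (\<Prod>i<n. normal_density 0 t (x i)))"
proof -
  have d: "distr (density lborel (\<lambda>x. ennreal (std_normal_density x))) lborel (\<lambda>x. t * x) =
      density lborel (\<lambda>x. ennreal (normal_density 0 t x))"
  proof -
    have "distributed (density lborel (\<lambda>x. ennreal (std_normal_density x))) lborel (\<lambda>x. x) (normal_density 0 1)"
      by (simp add: distributed_def distr_id2)
    from prob_space.normal_density_affine[OF prob_space_normal_density this, of t 0] t
    show ?thesis by (simp add: distributed_def)
  qed
  have "distr (gauss n) (\<Pi>\<^sub>M i\<in>{..<n}. lborel) (\<lambda>x. \<lambda>i\<in>{..<n}. t * x i) =
     distr (gauss n) (\<Pi>\<^sub>M i\<in>{..<n}. density lborel (\<lambda>x. ennreal (normal_density 0 t x))) (compose {..<n} (\<lambda>x. t * x))"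
    by (rule distr_cong) (auto simp: compose_def intro!: sets_PiM_cong)
  also have "\<dots> = (\<Pi>\<^sub>M i\<in>{..<n}. distr (density lborel (\<lambda>x. ennreal (std_normal_density x)))
      (density lborel (\<lambda>x. ennreal (normal_density 0 t x))) (\<lambda>x. t * x))"
    unfolding gauss_def using t
    by (intro distr_PiM_finite_prob_space') (auto intro!: prob_space_normal_density)
  also have "\<dots> = (\<Pi>\<^sub>M i\<in>{..<n}. density lborel (\<lambda>x. ennreal (normal_density 0 t x)))"
    by (subst d[symmetric]) (auto intro!: PiM_cong distr_cong)
  also have "\<dots> = density (\<Pi>\<^sub>M i\<in>{..<n}. lborel) (\<lambda>x. ennreal (\<Prod>i<n. normal_density 0 t (x i)))"
    by (rule PiM_density_lborel) (use t in \<open>auto simp: prob_space_normal_density\<close>)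
  finally show ?thesis .
qed

text \<open>The parallelogram identity in the exponent. The last factor quantifies strict
  log-concavity, and this gain is what pays for the difference \<open>f x - f y\<close> of a
  Lipschitz function.\<close>

lemma std_normal_density_midpoint:
  "std_normal_density x * std_normal_density y = (std_normal_density ((x + y) / 2))^2 * exp (- (x - y)\<^sup>2 / 4)"
proof -
  have "- x\<^sup>2 / 2 + - y\<^sup>2 / 2 = 2 * (- ((x + y) / 2)\<^sup>2 / 2) + - (x - y)\<^sup>2 / 4"
    by (simp add: power2_eq_square field_simps)
  then have "exp (- x\<^sup>2 / 2) * exp (- y\<^sup>2 / 2) = (exp (- ((x + y) / 2)\<^sup>2 / 2))^2 * exp (- (x - y)\<^sup>2 / 4)"
    by (simp only: exp_add[symmetric]) (simp only: exp_add exp_double)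
  then show ?thesis
    by (simp add: normal_density_def power_divide power_mult_distrib power2_eq_square field_simps)
qed

text \<open>Since \<open>f x - f y \<le> 1 + \<parallel>x - y\<parallel>\<^sup>2 / 4\<close>, the densities \<open>exp f\<close>, \<open>exp (- f)\<close> and the constant
  \<open>exp (1/2)\<close> with respect to the Gaussian measure satisfy the Prekopa-Leindler hypothesis.\<close>

lemma gauss_exp_integral_product:
  assumes [measurable]: "f \<in> borel_measurable (\<Pi>\<^sub>M i\<in>{..<n}. lborel)"
    and lip: "\<And>x y. x \<in> {..<n} \<rightarrow>\<^sub>E UNIV \<Longrightarrow> y \<in> {..<n} \<rightarrow>\<^sub>E UNIV \<Longrightarrow> \<bar>f x - f y\<bar> \<le> L2_set (\<lambda>i. x i - y i) {..<n}"
  shows "(\<integral>\<^sup>+x. ennreal (exp (f x)) \<partial>gauss n) * (\<integral>\<^sup>+x. ennreal (exp (- f x)) \<partial>gauss n) \<le> ennreal (exp 1)"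
proof -
  define \<gamma> where "\<gamma> x = (\<Prod>i<n. std_normal_density (x i))" for x
  have \<gamma>0: "0 \<le> \<gamma> x" for x by (auto simp: \<gamma>_def intro!: prod_nonneg)
  have [measurable]: "\<gamma> \<in> borel_measurable (\<Pi>\<^sub>M i\<in>{..<n}. lborel)"
    unfolding \<gamma>_def by measurable
  let ?L = "\<Pi>\<^sub>M i\<in>{..<n}. lborel :: real measure"
  have "(\<integral>\<^sup>+x. ennreal (\<gamma> x * exp (f x)) \<partial>?L) * (\<integral>\<^sup>+x. ennreal (\<gamma> x * exp (- f x)) \<partial>?L) \<le>
    (\<integral>\<^sup>+x. ennreal (exp (1/2) * \<gamma> x) \<partial>?L)^2"
  proof (rule prekopa_leindler_midpoint)
    fix x y :: "nat \<Rightarrow> real" assume xy: "x \<in> {..<n} \<rightarrow>\<^sub>E UNIV" "y \<in> {..<n} \<rightarrow>\<^sub>E UNIV"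
    define m where "m = (\<lambda>i\<in>{..<n}. (x i + y i) / 2)"
    define r where "r = L2_set (\<lambda>i. x i - y i) {..<n}"
    have r2: "r\<^sup>2 = (\<Sum>i<n. (x i - y i)\<^sup>2)"
      by (simp add: r_def L2_set_def sum_nonneg)
    have "\<gamma> x * \<gamma> y = (\<Prod>i<n. std_normal_density (x i) * std_normal_density (y i))"
      by (simp add: \<gamma>_def prod.distrib)
    also have "\<dots> = (\<Prod>i<n. (std_normal_density (m i))^2 * exp (- (x i - y i)\<^sup>2 / 4))"
      by (intro prod.cong refl) (simp add: std_normal_density_midpoint m_def)
    also have "\<dots> = (\<gamma> m)^2 * exp (- r\<^sup>2 / 4)"
      by (simp add: prod.distrib \<gamma>_def prod_power_distrib exp_sum[symmetric] r2 sum_negf[symmetric] sum_divide_distrib)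
    finally have \<gamma>: "\<gamma> x * \<gamma> y = (\<gamma> m)^2 * exp (- r\<^sup>2 / 4)" .
    have "f x - f y \<le> r" using lip[OF xy] by (simp add: r_def)
    also have "r \<le> 1 + r\<^sup>2 / 4"
      using zero_le_power2[of "r / 2 - 1"] by (simp add: power2_eq_square algebra_simps)
    finally have "exp (f x) * exp (- f y) * exp (- r\<^sup>2 / 4) \<le> exp 1"
      by (simp add: exp_add[symmetric])
    then have le: "(\<gamma> m)\<^sup>2 * (exp (f x) * exp (- f y) * exp (- r\<^sup>2 / 4)) \<le> (\<gamma> m)\<^sup>2 * exp 1"
      by (intro mult_left_mono) auto
    have "\<gamma> x * exp (f x) * (\<gamma> y * exp (- f y)) = (\<gamma> x * \<gamma> y) * (exp (f x) * exp (- f y))"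
      by (simp add: mult_ac)
    also have "\<dots> = (\<gamma> m)\<^sup>2 * (exp (f x) * exp (- f y) * exp (- r\<^sup>2 / 4))"
      unfolding \<gamma> by (simp only: mult_ac)
    also have "\<dots> \<le> (\<gamma> m)\<^sup>2 * exp 1" by (rule le)
    also have "\<dots> = (exp (1/2) * \<gamma> m)^2"
      by (simp add: power_mult_distrib exp_double[symmetric])
    finally show "ennreal (\<gamma> x * exp (f x)) * ennreal (\<gamma> y * exp (- f y)) \<le>
      (ennreal (exp (1/2) * \<gamma> (\<lambda>i\<in>{..<n}. (x i + y i) / 2)))^2"
      using \<gamma>0 by (simp add: m_def ennreal_mult[symmetric] ennreal_power ennreal_leI)
  qed auto
  also have "(\<integral>\<^sup>+x. ennreal (exp (1/2) * \<gamma> x) \<partial>?L) = ennreal (exp (1/2)) * 1"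
  proof -
    have "(\<integral>\<^sup>+x. ennreal (\<gamma> x) \<partial>?L) = emeasure (gauss n) (space ?L)"
      unfolding gauss_density \<gamma>_def[symmetric] by (subst emeasure_density) (auto intro!: nn_integral_cong)
    also have "space ?L = space (gauss n)"
      by (rule sets_eq_imp_space_eq[OF sets_gauss, symmetric])
    finally show ?thesis
      by (simp add: prob_space.emeasure_space_1[OF prob_space_gauss] ennreal_mult \<gamma>0 nn_integral_cmult)
  qed
  also have "(ennreal (exp (1/2)) * 1)^2 = ennreal (exp 1)"
    by (simp add: ennreal_power exp_double[symmetric])
  finally show ?thesis
    by (simp add: gauss_density nn_integral_density \<gamma>_def[symmetric] ennreal_mult \<gamma>0)
qed

section \<open>Second moments and the variance of Lipschitz functions\<close>

lemma integral_gauss_component: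
  assumes [measurable]: "h \<in> borel_measurable borel" and i: "i < n"
  shows "integrable (gauss n) (\<lambda>x. h (x i)) \<longleftrightarrow> integrable (density lborel (\<lambda>x. ennreal (std_normal_density x))) (h :: real \<Rightarrow> real)"
    "(\<integral>x. h (x i) \<partial>gauss n) = (\<integral>x. h x \<partial>density lborel (\<lambda>x. ennreal (std_normal_density x)))"
proof -
  let ?N = "density lborel (\<lambda>x. ennreal (std_normal_density x))"
  have d: "distr (gauss n) ?N (\<lambda>x. x i) = ?N"
    unfolding gauss_def using i by (intro distr_PiM_component prob_space_normal_density) auto
  have [measurable]: "(\<lambda>x. x i) \<in> gauss n \<rightarrow>\<^sub>M ?N"
    unfolding gauss_def using i by (intro measurable_component_singleton[where M="\<lambda>_. ?N"]) simp
  have "integrable (distr (gauss n) ?N (\<lambda>x. x i)) h \<longleftrightarrow> integrable (gauss n) (\<lambda>x. h (x i))"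
    using assms by (intro integrable_distr_eq) auto
  then show "integrable (gauss n) (\<lambda>x. h (x i)) \<longleftrightarrow> integrable ?N h" unfolding d by simp
  have "integral\<^sup>L (distr (gauss n) ?N (\<lambda>x. x i)) h = (\<integral>x. h (x i) \<partial>gauss n)"
    using assms by (intro integral_distr) auto
  then show "(\<integral>x. h (x i) \<partial>gauss n) = integral\<^sup>L ?N h" unfolding d by simp
qed

lemma gauss_component_square:
  assumes "i < n"
  shows "integrable (gauss n) (\<lambda>x. (x i)\<^sup>2)" "(\<integral>x. (x i)\<^sup>2 \<partial>gauss n) = 1"
proof -
  have "has_bochner_integral lborel (\<lambda>x. std_normal_density x * x ^ (2 * 1)) (fact (2 * 1) / (2 ^ 1 * fact 1))"
    by (rule std_normal_moment_even)
  then have h: "has_bochner_integral lborel (\<lambda>x. std_normal_density x * x\<^sup>2) 1"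
    by (simp add: fact_numeral)
  show "integrable (gauss n) (\<lambda>x. (x i)\<^sup>2)" "(\<integral>x. (x i)\<^sup>2 \<partial>gauss n) = 1"
    using h integral_gauss_component[of "\<lambda>x. x\<^sup>2" i n] assms
    by (auto simp: integrable_density integral_density has_bochner_integral_iff)
qed

lemma L2_set_square: "(L2_set x A)\<^sup>2 = (\<Sum>i\<in>A. (x i)\<^sup>2)"
  by (simp add: L2_set_def sum_nonneg)

lemma borel_measurable_L2_set [measurable]: "(\<lambda>x. L2_set x {..<n}) \<in> borel_measurable (\<Pi>\<^sub>M i\<in>{..<n}. lborel)"
  unfolding L2_set_def by measurable

lemma gauss_norm_square:
  "integrable (gauss n) (\<lambda>x. (L2_set x {..<n})\<^sup>2)" "(\<integral>x. (L2_set x {..<n})\<^sup>2 \<partial>gauss n) = n"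
proof -
  have "integrable (gauss n) (\<lambda>x. \<Sum>i<n. (x i)\<^sup>2)" "(\<integral>x. (\<Sum>i<n. (x i)\<^sup>2) \<partial>gauss n) = (\<Sum>i<n. 1)"
    by (auto simp: gauss_component_square intro!: Bochner_Integration.integrable_sum)
  then show "integrable (gauss n) (\<lambda>x. (L2_set x {..<n})\<^sup>2)" "(\<integral>x. (L2_set x {..<n})\<^sup>2 \<partial>gauss n) = n"
    by (simp_all add: L2_set_square)
qed

lemma gauss_integrable_of_square:
  fixes f :: "(nat \<Rightarrow> real) \<Rightarrow> real"
  assumes [measurable]: "f \<in> borel_measurable (gauss n)" and "integrable (gauss n) (\<lambda>x. (f x)\<^sup>2)"
  shows "integrable (gauss n) f"
proof -
  interpret prob_space "gauss n" by (rule prob_space_gauss)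
  have "integrable (gauss n) (\<lambda>x. 1 + (f x)\<^sup>2)" using assms by simp
  then show ?thesis
  proof (rule Bochner_Integration.integrable_bound)
    have "\<bar>u\<bar> \<le> \<bar>1 + u\<^sup>2\<bar>" for u :: real
    proof -
      have "0 \<le> (\<bar>u\<bar> - 1)\<^sup>2" by simp
      also have "(\<bar>u\<bar> - 1)\<^sup>2 = u\<^sup>2 - 2 * \<bar>u\<bar> + 1" by (simp only: power2_diff power2_abs) simp
      finally show ?thesis using zero_le_power2[of u] by linarith
    qed
    then show "AE x in gauss n. norm (f x) \<le> norm (1 + (f x)\<^sup>2)" by simp
  qed simp
qed

lemma gauss_Lipschitz_integrable:
  assumes [measurable]: "f \<in> borel_measurable (\<Pi>\<^sub>M i\<in>{..<n}. lborel)"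
    and lip: "\<And>x y. x \<in> {..<n} \<rightarrow>\<^sub>E UNIV \<Longrightarrow> y \<in> {..<n} \<rightarrow>\<^sub>E UNIV \<Longrightarrow> \<bar>f x - f y\<bar> \<le> L * L2_set (\<lambda>i. x i - y i) {..<n}"
  shows "integrable (gauss n) f" "integrable (gauss n) (\<lambda>x. (f x)\<^sup>2)"
proof -
  interpret prob_space "gauss n" by (rule prob_space_gauss)
  define z where "z = (\<lambda>i\<in>{..<n}. 0 :: real)"
  have z: "z \<in> {..<n} \<rightarrow>\<^sub>E UNIV" by (auto simp: z_def)
  have bound: "(f x)\<^sup>2 \<le> 2 * (f z)\<^sup>2 + 2 * L\<^sup>2 * (L2_set x {..<n})\<^sup>2" if x: "x \<in> {..<n} \<rightarrow>\<^sub>E UNIV" for x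
  proof -
    have "L2_set (\<lambda>i. x i - z i) {..<n} = L2_set x {..<n}"
      by (intro L2_set_cong) (auto simp: z_def)
    then have "\<bar>f x - f z\<bar> \<le> L * L2_set x {..<n}"
      using lip[OF x z] by simp
    then have "\<bar>f x - f z\<bar>\<^sup>2 \<le> (L * L2_set x {..<n})\<^sup>2"
      by (intro power_mono) auto
    then have 1: "(f x - f z)\<^sup>2 \<le> L\<^sup>2 * (L2_set x {..<n})\<^sup>2"
      by (simp only: power2_abs power_mult_distrib)
    \<comment> \<open>This square is the inequality \<open>a^2 \<le> 2 * b^2 + 2 * (a - b)^2\<close>
      for \<open>a = f x\<close> and \<open>b = f z\<close>.\<close>
    have "0 \<le> (f x - 2 * f z)\<^sup>2" by simp
    also have "\<dots> = 2 * (f z)\<^sup>2 + 2 * (f x - f z)\<^sup>2 - (f x)\<^sup>2"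
      by (simp only: power2_diff power_mult_distrib) simp
    finally show ?thesis using 1 by linarith
  qed
  have 2: "integrable (gauss n) (\<lambda>x. 2 * (f z)\<^sup>2 + 2 * L\<^sup>2 * (L2_set x {..<n})\<^sup>2)"
    by (intro Bochner_Integration.integrable_add integrable_mult_right gauss_norm_square(1)) simp
  have 3: "AE x in gauss n. norm ((f x)\<^sup>2) \<le> norm (2 * (f z)\<^sup>2 + 2 * L\<^sup>2 * (L2_set x {..<n})\<^sup>2)"
    using bound by (intro AE_I2) (simp add: space_gauss)
  show "integrable (gauss n) (\<lambda>x. (f x)\<^sup>2)"
    by (rule Bochner_Integration.integrable_bound[OF 2 _ 3]) simp
  then show "integrable (gauss n) f" by (rule gauss_integrable_of_square[rotated]) simp
qed

text \<open>\<open>exp u + exp (- u) - 2\<close> equals \<open>4 * sinh (u/2)^2\<close>, and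
  \<open>\<bar>sinh v\<bar> \<ge> \<bar>v\<bar>\<close>. The inequality converts a bound on
  exponential integrals into a bound on the variance.\<close>

lemma square_le_exp_plus_exp_minus: "u\<^sup>2 + 2 \<le> exp u + exp (- u)" for u :: real
proof -
  have "\<bar>u/2\<bar>\<^sup>2 \<le> \<bar>(exp (u/2) - inverse (exp (u/2))) / 2\<bar>\<^sup>2"
    by (rule power_mono[OF real_le_abs_sinh]) simp
  then have "u\<^sup>2 \<le> (exp (u/2) - exp (- (u/2)))\<^sup>2"
    by (simp add: power_divide exp_minus)
  also have "\<dots> = exp (u/2) ^ 2 + exp (- (u/2)) ^ 2 - 2 * (exp (u/2) * exp (- (u/2)))"
    by (simp only: power2_diff mult.assoc)
  also have "\<dots> = exp u + exp (- u) - 2"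
    by (simp add: exp_double[symmetric] exp_add[symmetric])
  finally show ?thesis by simp
qed

text \<open>The integrals \<open>p\<close> of \<open>exp g\<close> and \<open>q\<close> of
  \<open>exp (- g)\<close> for the centred function \<open>g\<close> are both at least 1, and their
  product is at most \<open>exp 1\<close>. From \<open>(p - 1) * (q - 1) \<ge> 0\<close> follows
  \<open>p + q \<le> 1 + p * q \<le> 1 + exp 1 \<le> 4\<close>, and
  \<open>g^2 + 2 \<le> exp g + exp (- g)\<close> leaves 2 for the variance.\<close>

lemma gauss_variance_1_Lipschitz:
  assumes [measurable]: "f \<in> borel_measurable (\<Pi>\<^sub>M i\<in>{..<n}. lborel)"
    and lip: "\<And>x y. x \<in> {..<n} \<rightarrow>\<^sub>E UNIV \<Longrightarrow> y \<in> {..<n} \<rightarrow>\<^sub>E UNIV \<Longrightarrow> \<bar>f x - f y\<bar> \<le> L2_set (\<lambda>i. x i - y i) {..<n}"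
  shows "(\<integral>x. (f x - (\<integral>y. f y \<partial>gauss n))\<^sup>2 \<partial>gauss n) \<le> 2"
proof -
  interpret prob_space "gauss n" by (rule prob_space_gauss)
  define g where "g x = f x - (\<integral>y. f y \<partial>gauss n)" for x
  have [measurable]: "g \<in> borel_measurable (\<Pi>\<^sub>M i\<in>{..<n}. lborel)" unfolding g_def by measurable
  have glip: "\<bar>g x - g y\<bar> \<le> L2_set (\<lambda>i. x i - y i) {..<n}"
    if "x \<in> {..<n} \<rightarrow>\<^sub>E UNIV" "y \<in> {..<n} \<rightarrow>\<^sub>E UNIV" for x y
    using lip[OF that] by (simp add: g_def)
  have int: "integrable (gauss n) g" "integrable (gauss n) (\<lambda>x. (g x)\<^sup>2)"
    using gauss_Lipschitz_integrable[of g n 1] glip by auto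
  have "integrable (gauss n) f" using gauss_Lipschitz_integrable[of f n 1] lip by auto
  then have mean: "(\<integral>x. g x \<partial>gauss n) = 0" by (simp add: g_def prob_space)
  \<comment> \<open>Jensen's inequality for \<open>exp\<close>, obtained from
    \<open>1 + u \<le> exp u\<close>. The positive part appears because the right side is an
    integral of nonnegative functions.\<close>
  have one_le: "1 \<le> (\<integral>\<^sup>+x. ennreal (exp (u x)) \<partial>gauss n)"
    if u: "integrable (gauss n) u" "(\<integral>x. u x \<partial>gauss n) = 0" for u
  proof -
    have "ennreal (\<integral>x. 1 + u x \<partial>gauss n) \<le> ennreal (\<integral>x. max 0 (1 + u x) \<partial>gauss n)"
      using u by (intro ennreal_leI integral_mono) auto
    also have "\<dots> = (\<integral>\<^sup>+x. ennreal (max 0 (1 + u x)) \<partial>gauss n)"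
      using u by (intro nn_integral_eq_integral[symmetric]) auto
    also have "\<dots> \<le> (\<integral>\<^sup>+x. ennreal (exp (u x)) \<partial>gauss n)"
      by (intro nn_integral_mono ennreal_leI) (auto simp: exp_ge_add_one_self)
    finally show ?thesis using u by (simp add: prob_space)
  qed
  define p q where "p = (\<integral>\<^sup>+x. ennreal (exp (g x)) \<partial>gauss n)" and "q = (\<integral>\<^sup>+x. ennreal (exp (- g x)) \<partial>gauss n)"
  have p1: "1 \<le> p" and q1: "1 \<le> q"
    using one_le[of g] one_le[of "\<lambda>x. - g x"] int mean by (auto simp: p_def q_def)
  have pq: "p * q \<le> ennreal (exp 1)"
    unfolding p_def q_def using glip by (intro gauss_exp_integral_product) auto
  \<comment> \<open>If one factor were infinite, the product would be too, since the other factor is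
    at least 1.\<close>
  have "p \<noteq> \<top>" "q \<noteq> \<top>"
    using pq p1 q1 by (auto simp: ennreal_top_mult ennreal_mult_top top_unique split: if_splits)
  then obtain a b where ab: "p = ennreal a" "0 \<le> a" "q = ennreal b" "0 \<le> b"
    by (cases p; cases q) auto
  then have ab1: "1 \<le> a" "1 \<le> b" "a * b \<le> exp 1"
    using p1 q1 pq by (auto simp: ennreal_mult[symmetric])
  have "0 \<le> (a - 1) * (b - 1)" using ab1 by simp
  then have ab_sum: "a + b \<le> 1 + exp 1" using ab1 by (simp add: algebra_simps)
  have "ennreal ((\<integral>x. (g x)\<^sup>2 \<partial>gauss n) + 2) = (\<integral>\<^sup>+x. ennreal ((g x)\<^sup>2 + 2) \<partial>gauss n)"
    using int by (subst nn_integral_eq_integral) (auto simp: prob_space)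
  also have "\<dots> \<le> (\<integral>\<^sup>+x. ennreal (exp (g x)) + ennreal (exp (- g x)) \<partial>gauss n)"
    using square_le_exp_plus_exp_minus by (intro nn_integral_mono) (simp add: ennreal_plus[symmetric] del: ennreal_plus)
  also have "\<dots> = p + q" by (simp add: p_def q_def nn_integral_add)
  also have "\<dots> = ennreal (a + b)" using ab by simp
  finally have "(\<integral>x. (g x)\<^sup>2 \<partial>gauss n) + 2 \<le> a + b"
    using ab by (subst (asm) ennreal_le_iff) auto
  then show ?thesis using ab_sum exp_le by (simp add: g_def)
qed

lemma gauss_variance_Lipschitz:
  assumes [measurable]: "f \<in> borel_measurable (\<Pi>\<^sub>M i\<in>{..<n}. lborel)" and L: "0 < L"
    and lip: "\<And>x y. x \<in> {..<n} \<rightarrow>\<^sub>E UNIV \<Longrightarrow> y \<in> {..<n} \<rightarrow>\<^sub>E UNIV \<Longrightarrow> \<bar>f x - f y\<bar> \<le> L * L2_set (\<lambda>i. x i - y i) {..<n}"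
  shows "(\<integral>x. (f x - (\<integral>y. f y \<partial>gauss n))\<^sup>2 \<partial>gauss n) \<le> 2 * L\<^sup>2"
proof -
  have "\<bar>f x / L - f y / L\<bar> \<le> L2_set (\<lambda>i. x i - y i) {..<n}"
    if "x \<in> {..<n} \<rightarrow>\<^sub>E UNIV" "y \<in> {..<n} \<rightarrow>\<^sub>E UNIV" for x y
    using lip[OF that] L by (simp add: diff_divide_distrib[symmetric] pos_divide_le_eq mult.commute)
  then have "(\<integral>x. (f x / L - (\<integral>y. f y / L \<partial>gauss n))\<^sup>2 \<partial>gauss n) \<le> 2"
    by (intro gauss_variance_1_Lipschitz) auto
  also have "(\<lambda>x. (f x / L - (\<integral>y. f y / L \<partial>gauss n))\<^sup>2) = (\<lambda>x. (f x - (\<integral>y. f y \<partial>gauss n))\<^sup>2 / L\<^sup>2)"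
    by (simp add: diff_divide_distrib[symmetric] power_divide)
  finally show ?thesis using L by (simp add: pos_divide_le_eq)
qed

section \<open>Concentration of the Gaussian norm\<close>

lemma L2_set_triangle_diff:
  "\<bar>L2_set x A - L2_set y A\<bar> \<le> L2_set (\<lambda>i. x i - y i) A"
proof -
  have "L2_set (\<lambda>i. y i + (x i - y i)) A \<le> L2_set y A + L2_set (\<lambda>i. x i - y i) A"
    "L2_set (\<lambda>i. x i + (y i - x i)) A \<le> L2_set x A + L2_set (\<lambda>i. y i - x i) A"
    by (rule L2_set_triangle_ineq)+
  moreover have "L2_set (\<lambda>i. y i - x i) A = L2_set (\<lambda>i. x i - y i) A"
    unfolding L2_set_def by (intro arg_cong[where f=sqrt] sum.cong refl power2_commute)
  ultimately show ?thesis by simp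
qed

text \<open>The norm is 1-Lipschitz with second moment \<open>n\<close>, so its variance is
  \<open>n - (m n)^2\<close>. Nonnegativity of the variance gives the upper bound on the mean; the
  dimension-free variance bound gives the lower one.\<close>

lemma gauss_norm_mean:
  defines "m \<equiv> \<lambda>n. \<integral>x. L2_set x {..<n} \<partial>gauss n"
  shows "integrable (gauss n) (\<lambda>x. L2_set x {..<n})" "0 \<le> m n" "m n \<le> sqrt n" "n - (m n)\<^sup>2 \<le> 2"
proof -
  interpret prob_space "gauss n" by (rule prob_space_gauss)
  show i: "integrable (gauss n) (\<lambda>x. L2_set x {..<n})"
    by (rule gauss_integrable_of_square[OF _ gauss_norm_square(1)]) simp
  show "0 \<le> m n" unfolding m_def by (intro integral_nonneg_AE AE_I2) simp
  have "(\<integral>x. (L2_set x {..<n} - m n)\<^sup>2 \<partial>gauss n) = n - (m n)\<^sup>2"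
    using variance_eq[OF i gauss_norm_square(1)] by (simp add: m_def gauss_norm_square)
  moreover have "0 \<le> (\<integral>x. (L2_set x {..<n} - m n)\<^sup>2 \<partial>gauss n)"
    by (intro integral_nonneg_AE AE_I2) simp
  moreover have "(\<integral>x. (L2_set x {..<n} - m n)\<^sup>2 \<partial>gauss n) \<le> 2"
    unfolding m_def by (intro gauss_variance_1_Lipschitz L2_set_triangle_diff) simp
  ultimately show "n - (m n)\<^sup>2 \<le> 2" "m n \<le> sqrt n"
    by (auto intro: real_le_rsqrt)
qed

text \<open>The deviation is measured from \<open>sqrt n\<close>, not from the mean
  \<open>m\<close>. Its second moment is \<open>2 * sqrt n * (sqrt n - m)\<close>; enlarging the
  factor \<open>sqrt n\<close> to \<open>sqrt n + m\<close> bounds it by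
  \<open>2 * (n - m^2)\<close>, which is at most 4.\<close>

lemma gauss_norm_deviation:
  "integrable (gauss n) (\<lambda>x. (L2_set x {..<n} - sqrt n)\<^sup>2)"
  "(\<integral>x. (L2_set x {..<n} - sqrt n)\<^sup>2 \<partial>gauss n) \<le> 4"
proof -
  interpret prob_space "gauss n" by (rule prob_space_gauss)
  define m where "m = (\<integral>x. L2_set x {..<n} \<partial>gauss n)"
  note m = gauss_norm_mean[of n, folded m_def]
  have eq: "(\<lambda>x. (L2_set x {..<n} - sqrt n)\<^sup>2) = (\<lambda>x. (L2_set x {..<n})\<^sup>2 - 2 * sqrt n * L2_set x {..<n} + n)"
    by (simp add: power2_diff fun_eq_iff)
  show "integrable (gauss n) (\<lambda>x. (L2_set x {..<n} - sqrt n)\<^sup>2)"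
    unfolding eq using m gauss_norm_square by simp
  have e: "(\<integral>x. (L2_set x {..<n} - sqrt n)\<^sup>2 \<partial>gauss n) = 2 * sqrt n * (sqrt n - m)"
    unfolding eq using m gauss_norm_square by (simp add: prob_space m_def algebra_simps)
  have "sqrt n * (sqrt n - m) \<le> (sqrt n + m) * (sqrt n - m)"
    using m by (intro mult_right_mono) auto
  also have "(sqrt n + m) * (sqrt n - m) = n - m\<^sup>2"
    by (simp add: algebra_simps power2_eq_square)
  finally have "2 * sqrt n * (sqrt n - m) \<le> 2 * (n - m\<^sup>2)" by simp
  also have "\<dots> \<le> 4" using m by simp
  finally show "(\<integral>x. (L2_set x {..<n} - sqrt n)\<^sup>2 \<partial>gauss n) \<le> 4" unfolding e .
qed

section \<open>Parameters of product spaces\<close>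

definition binary_digit :: "real \<Rightarrow> nat \<Rightarrow> int" where
  "binary_digit x k = \<lfloor>2 ^ Suc k * x\<rfloor> mod 2"

text \<open>The partial sums are the truncations \<open>\<lfloor>2 ^ n * x\<rfloor> / 2 ^ n\<close>,
  which lie within \<open>(1/2) ^ n\<close> of \<open>x\<close>. The bounds on \<open>x\<close> make
  the truncation at \<open>n = 0\<close> vanish, so that no integer part is lost.\<close>

lemma binary_digit_sums:
  assumes "0 \<le> x" "x < 1"
  shows "(\<lambda>k. of_int (binary_digit x k) / 2 ^ Suc k) sums x"
proof -
  have partial: "(\<Sum>k<n. of_int (binary_digit x k) / 2 ^ Suc k :: real) = of_int \<lfloor>2 ^ n * x\<rfloor> / 2 ^ n" for n
  proof (induction n)
    case 0
    have "\<lfloor>x\<rfloor> = 0" using assms by linarith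
    then show ?case by simp
  next
    case (Suc n)
    have "\<lfloor>2 ^ Suc n * x\<rfloor> div 2 = \<lfloor>2 ^ n * x\<rfloor>"
      using floor_divide_real_eq_div[of 2 "2 ^ Suc n * x"] by (simp add: mult.assoc)
    then have "\<lfloor>2 ^ Suc n * x\<rfloor> = 2 * \<lfloor>2 ^ n * x\<rfloor> + binary_digit x n"
      using div_mult_mod_eq[of "\<lfloor>2 ^ Suc n * x\<rfloor>" 2] by (simp add: binary_digit_def)
    then show ?case using Suc by (simp add: field_simps)
  qed
  have "(\<lambda>n. of_int \<lfloor>2 ^ n * x\<rfloor> / 2 ^ n) \<longlonglongrightarrow> x"
  proof (rule tendsto_sandwich)
    show "\<forall>\<^sub>F n in sequentially. x - (1/2)^n \<le> of_int \<lfloor>2 ^ n * x\<rfloor> / 2 ^ n"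
    proof (intro always_eventually allI)
      fix n
      have "2 ^ n * x - 1 \<le> of_int \<lfloor>2 ^ n * x\<rfloor>" by linarith
      then have "(2 ^ n * x - 1) / 2 ^ n \<le> of_int \<lfloor>2 ^ n * x\<rfloor> / 2 ^ n"
        by (rule divide_right_mono) simp
      then show "x - (1/2)^n \<le> of_int \<lfloor>2 ^ n * x\<rfloor> / 2 ^ n"
        by (simp add: diff_divide_distrib power_one_over)
    qed
    show "\<forall>\<^sub>F n in sequentially. of_int \<lfloor>2 ^ n * x\<rfloor> / 2 ^ n \<le> x"
      by (intro always_eventually allI) (simp add: field_simps)
    have "(\<lambda>n. x - (1/2)^n) \<longlonglongrightarrow> x - 0"
      by (intro tendsto_intros LIMSEQ_power_zero) auto
    then show "(\<lambda>n. x - (1/2)^n) \<longlonglongrightarrow> x" by simp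
  qed simp
  then show ?thesis unfolding sums_def partial .
qed

text \<open>In base 4 the digits 0 and 1 can be recovered from the value, because no carries occur.\<close>

definition base4 :: "(nat \<Rightarrow> int) \<Rightarrow> real" where
  "base4 c = (\<Sum>m. of_int (c m) / 4 ^ Suc m)"

lemma base4_summable:
  assumes "\<And>m. c m \<in> {0, 1}"
  shows "summable (\<lambda>m. of_int (c m) / 4 ^ Suc m :: real)"
proof (rule summable_comparison_test')
  show "summable (\<lambda>m. (1/4::real) ^ m)" by (rule summable_geometric) simp
  fix m show "norm (of_int (c m) / 4 ^ Suc m :: real) \<le> (1/4) ^ m"
    using assms[of m] by (auto simp: power_divide field_simps)
qed

lemma base4_split:
  assumes "\<And>m. c m \<in> {0, 1}"
  shows "base4 c = of_int (c 0) / 4 + base4 (\<lambda>m. c (Suc m)) / 4"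
proof -
  have "base4 c = (\<Sum>m. of_int (c (Suc m)) / 4 ^ Suc (Suc m)) + of_int (c 0) / 4"
    using suminf_split_head[OF base4_summable[of c]] assms by (simp add: base4_def)
  also have "(\<Sum>m. of_int (c (Suc m)) / 4 ^ Suc (Suc m)) = (\<Sum>m. of_int (c (Suc m)) / 4 ^ Suc m / 4 :: real)"
    by (intro suminf_cong) simp
  also have "\<dots> = base4 (\<lambda>m. c (Suc m)) / 4"
    unfolding base4_def by (rule suminf_divide) (rule base4_summable, rule assms)
  finally show ?thesis by simp
qed

text \<open>After multiplication by 4 the digits behind the leading one contribute at most 1/3, so
  the floor isolates the leading digit. The later digits are reached by shifting the
  sequence.\<close>

lemma base4_digit:
  assumes c: "\<And>m. c m \<in> {0, 1}"
  shows "\<lfloor>4 ^ Suc m * base4 c\<rfloor> mod 4 = c m"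
  using c
proof (induction m arbitrary: c)
  case 0
  define d where "d m = c (Suc m)" for m
  have "base4 c = of_int (c 0) / 4 + base4 d / 4"
    unfolding d_def by (rule base4_split[OF 0])
  moreover have "0 \<le> base4 d"
    unfolding base4_def
  proof (intro suminf_nonneg base4_summable)
    fix m have "d m \<in> {0, 1}" using 0 by (simp add: d_def)
    then show "d m \<in> {0, 1}" "0 \<le> of_int (d m) / (4 ^ Suc m :: real)" by auto
  qed
  moreover have "base4 d < 1"
  proof -
    have "base4 d \<le> (\<Sum>m. 1/4 * (1/4::real) ^ m)"
      unfolding base4_def
    proof (rule suminf_le)
      show "summable (\<lambda>m. of_int (d m) / 4 ^ Suc m :: real)" by (rule base4_summable) (use 0 in \<open>auto simp: d_def\<close>)
      show "summable (\<lambda>m. 1/4 * (1/4::real) ^ m)" by (intro summable_mult summable_geometric) simp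
      fix m show "of_int (d m) / 4 ^ Suc m \<le> 1/4 * (1/4::real) ^ m"
        using 0[of "Suc m"] by (auto simp: d_def power_divide)
    qed
    also have "\<dots> = 1/3" by (subst suminf_mult) (auto simp: suminf_geometric)
    finally show ?thesis by simp
  qed
  ultimately have "\<lfloor>4 ^ Suc 0 * base4 c\<rfloor> = c 0" by (simp add: floor_eq_iff)
  then show ?case using 0[of 0] by auto
next
  case (Suc m)
  define d where "d m = c (Suc m)" for m
  have "base4 c = of_int (c 0) / 4 + base4 d / 4"
    unfolding d_def by (rule base4_split[OF Suc.prems])
  then have e: "4 * base4 c = base4 d + of_int (c 0)" by simp
  have "4 ^ Suc (Suc m) * base4 c = 4 ^ Suc m * (4 * base4 c)" by simp
  also have "\<dots> = 4 ^ Suc m * base4 d + of_int (4 * (4 ^ m * c 0))"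
    unfolding e by (simp add: algebra_simps)
  finally have "4 ^ Suc (Suc m) * base4 c = 4 ^ Suc m * base4 d + of_int (4 * (4 ^ m * c 0))" .
  \<comment> \<open>The leading digit contributes an integer multiple of 4, which is invisible
    modulo 4.\<close>
  then have "\<lfloor>4 ^ Suc (Suc m) * base4 c\<rfloor> = \<lfloor>4 ^ Suc m * base4 d\<rfloor> + 4 * (4 ^ m * c 0)"
    by (simp only: floor_add_int)
  then have "\<lfloor>4 ^ Suc (Suc m) * base4 c\<rfloor> mod 4 = \<lfloor>4 ^ Suc m * base4 d\<rfloor> mod 4" by simp
  also have "\<dots> = d m" by (rule Suc.IH) (use Suc.prems in \<open>auto simp: d_def\<close>)
  finally show ?case by (simp add: d_def)
qed

text \<open>The rescaled \<open>arctan\<close> carries each coordinate into \<open>{0<..<1}\<close>,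
  and \<open>prod_decode\<close> interleaves the binary digits of all coordinates into one digit
  sequence. Reading that sequence in base 4 gives a code with a Borel left inverse,
  \<open>decode_seq\<close>.\<close>

definition encode_seq :: "(nat \<Rightarrow> real) \<Rightarrow> real" where
  "encode_seq x = base4 (\<lambda>m. case prod_decode m of (i, k) \<Rightarrow> binary_digit (1/2 + arctan (x i) / pi) k)"

definition decode_seq :: "real \<Rightarrow> nat \<Rightarrow> real" where
  "decode_seq r i = tan (pi * ((\<Sum>k. of_int (\<lfloor>4 ^ Suc (prod_encode (i, k)) * r\<rfloor> mod 4) / 2 ^ Suc k) - 1/2))"

lemma decode_encode_seq [simp]: "decode_seq (encode_seq x) i = x i"
proof -
  define y where "y i = 1/2 + arctan (x i) / pi" for i
  have y: "0 \<le> y i" "y i < 1" for i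
    using arctan_lbound[of "x i"] arctan_ubound[of "x i"] by (auto simp: y_def field_simps)
  have "\<lfloor>4 ^ Suc (prod_encode (i, k)) * encode_seq x\<rfloor> mod 4 = binary_digit (y i) k" for k
    unfolding encode_seq_def by (subst base4_digit) (auto simp: y_def binary_digit_def split: prod.split)
  then have "decode_seq (encode_seq x) i = tan (pi * (y i - 1/2))"
    using binary_digit_sums[OF y] by (simp add: decode_seq_def sums_iff)
  also have "\<dots> = x i" by (simp add: y_def tan_arctan)
  finally show ?thesis .
qed

lemma measurable_encode_seq [measurable]:
  assumes [measurable]: "\<And>i. (\<lambda>z. X z i) \<in> borel_measurable M"
  shows "(\<lambda>z. encode_seq (X z)) \<in> borel_measurable M"
proof -
  have [measurable]: "arctan \<in> borel_measurable borel"
    by (intro borel_measurable_continuous_onI continuous_intros)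
  have "(\<lambda>z. of_int (case prod_decode m of (i, k) \<Rightarrow> binary_digit (1/2 + arctan (X z i) / pi) k) / 4 ^ Suc m :: real)
    \<in> borel_measurable M" for m
    unfolding binary_digit_def by (cases "prod_decode m") simp
  then show ?thesis unfolding encode_seq_def base4_def by (intro borel_measurable_suminf)
qed

lemma measurable_decode_seq [measurable]: "(\<lambda>r. decode_seq r i) \<in> borel_measurable borel"
proof -
  have [measurable]: "tan \<in> borel_measurable (borel :: real measure)"
    unfolding tan_def by (intro borel_measurable_divide borel_measurable_continuous_onI continuous_intros)
  show ?thesis unfolding decode_seq_def by measurable
qed

text \<open>The quantile function \<open>I\<close>, the generalized inverse of the distribution
  function, carries Lebesgue measure on \<open>{0<..<1}\<close> to \<open>M\<close>. The value 0
  given to \<open>\<theta>\<close> at the two end points affects only a null set.\<close>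

lemma parameter_real:
  assumes "prob_space M" "sets M = sets (borel :: real measure)"
  shows "\<exists>\<theta>. \<theta> \<in> unit_lborel \<rightarrow>\<^sub>M borel \<and> distr unit_lborel borel \<theta> = M"
proof -
  interpret prob_space M by fact
  interpret cdf_distribution M
    unfolding cdf_distribution_def real_distribution_def real_distribution_axioms_def
    using assms by (auto dest: sets_eq_imp_space_eq)
  define \<theta> where "\<theta> u = (if u \<in> {0<..<1} then I u else 0)" for u
  have [measurable]: "\<theta> \<in> borel_measurable borel"
    unfolding \<theta>_def using measurable_CI
    by (subst (asm) measurable_restrict_space_iff[where c=0]) (auto simp: if_distrib cong: if_cong)
  have m: "\<theta> \<in> unit_lborel \<rightarrow>\<^sub>M borel" by (auto intro!: measurable_restrict_space1)
  have "distr unit_lborel borel \<theta> = distr (restrict_space lborel {0<..<1}) borel I"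
  proof (rule measure_eqI)
    fix A assume "A \<in> sets (distr unit_lborel borel \<theta>)"
    then have [measurable]: "A \<in> sets borel" by simp
    have mI: "I \<in> restrict_space lborel {0<..<1} \<rightarrow>\<^sub>M borel"
      using measurable_CI by (simp add: measurable_def space_restrict_space sets_restrict_space)
    have "emeasure (distr unit_lborel borel \<theta>) A = emeasure lborel (\<theta> -` A \<inter> {0..1})"
      using m by (simp add: emeasure_distr emeasure_restrict_space space_restrict_space)
    also have "\<dots> = emeasure lborel (\<theta> -` A \<inter> {0<..<1})"
    proof (rule emeasure_eq_AE)
      show "AE x in lborel. (x \<in> \<theta> -` A \<inter> {0..1}) = (x \<in> \<theta> -` A \<inter> {0<..<1})"
        using AE_lborel_singleton[of 0] AE_lborel_singleton[of 1] by eventually_elim auto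
      have "\<theta> -` A \<in> sets borel" using measurable_sets[of \<theta> borel borel A] by simp
      then show "\<theta> -` A \<inter> {0..1} \<in> sets lborel" "\<theta> -` A \<inter> {0<..<1} \<in> sets lborel" by auto
    qed
    also have "\<theta> -` A \<inter> {0<..<1} = I -` A \<inter> {0<..<1}" by (auto simp: \<theta>_def)
    also have "emeasure lborel \<dots> = emeasure (distr (restrict_space lborel {0<..<1}) borel I) A"
      using mI by (simp add: emeasure_distr emeasure_restrict_space space_restrict_space)
    finally show "emeasure (distr unit_lborel borel \<theta>) A = emeasure (distr (restrict_space lborel {0<..<1}) borel I) A" .
  qed simp
  then show ?thesis using m distr_I_eq_M by auto
qed

text \<open>The law of \<open>J\<close> is a law on the line and has a parameter
  \<open>\<theta>\<close>; then \<open>K \<circ> \<theta>\<close> has the law of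
  \<open>K \<circ> J\<close>, which is the identity on the space. A one-sided inverse is enough, so
  \<open>J\<close> may be far from onto.\<close>

lemma parameter_of_encoding:
  assumes "prob_space M"
    and [measurable]: "J \<in> borel_measurable M" "K \<in> borel \<rightarrow>\<^sub>M M"
    and KJ: "\<And>z. z \<in> space M \<Longrightarrow> K (J z :: real) = z"
  shows "\<exists>\<theta>. \<theta> \<in> unit_lborel \<rightarrow>\<^sub>M M \<and> distr unit_lborel M \<theta> = M"
proof -
  interpret prob_space M by fact
  obtain \<theta> where \<theta>[measurable]: "\<theta> \<in> unit_lborel \<rightarrow>\<^sub>M borel" and d: "distr unit_lborel borel \<theta> = distr M borel J"
    using parameter_real[OF prob_space_distr[of J borel]] by auto
  have "distr unit_lborel M (K \<circ> \<theta>) = distr (distr unit_lborel borel \<theta>) M K"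
    by (simp add: distr_distr)
  also have "\<dots> = distr M M (\<lambda>z. K (J z))"
    by (simp add: d distr_distr comp_def)
  also have "\<dots> = distr M M (\<lambda>z. z)"
    by (rule distr_cong) (auto simp: KJ)
  finally show ?thesis by (intro exI[of _ "K \<circ> \<theta>"]) (auto simp: distr_id2)
qed

section \<open>Metric measure spaces on Euclidean space and the half line\<close>

lemma (in Metric_space) openin_mtopology_countable_Union_mball:
  assumes U: "openin mtopology U" and dense: "mtopology closure_of C = M"
  shows "U = \<Union>{mball y (of_rat q) |y q. y \<in> C \<and> mball y (of_rat q) \<subseteq> U}"
proof
  show "U \<subseteq> \<Union>{mball y (of_rat q) |y q. y \<in> C \<and> mball y (of_rat q) \<subseteq> U}"
  proof
    fix x assume x: "x \<in> U"
    then obtain r where r: "r > 0" "mball x r \<subseteq> U" and xM: "x \<in> M"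
      using U unfolding openin_mtopology by blast
    \<comment> \<open>With the radius below \<open>r / 2\<close> and \<open>y\<close> within that
      radius of \<open>x\<close>, the ball around \<open>y\<close> contains \<open>x\<close> and
      stays inside \<open>mball x r\<close>.\<close>
    obtain q where q: "0 < real_of_rat q" "of_rat q < r / 2"
      using of_rat_dense[of 0 "r/2"] r by auto
    have "x \<in> mtopology closure_of C" using dense xM by simp
    then obtain y where y: "y \<in> C" "y \<in> mball x (of_rat q)"
      using q unfolding metric_closure_of by blast
    have "mball y (of_rat q) \<subseteq> mball x r"
      using y q xM by (intro mball_subset) (auto simp: commute)
    moreover have "x \<in> mball y (of_rat q)" using y by (auto simp: commute)
    ultimately show "x \<in> \<Union>{mball y (of_rat q) |y q. y \<in> C \<and> mball y (of_rat q) \<subseteq> U}"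
      using y r by blast
  qed
qed blast

lemma (in Metric_space) openin_subset_Pow: "{U. openin mtopology U} \<subseteq> Pow M"
  by (auto simp: openin_mtopology)

text \<open>By separability every open set is a countable union of balls of rational radius around
  points of \<open>C\<close>, so measurability of balls yields that of all open sets.\<close>

lemma sets_sigma_openin_eqI:
  assumes "Metric_space M d" and spc: "space N = M"
    and countable: "countable C" and dense: "Metric_space.mtopology M d closure_of C = M"
    and balls: "\<And>x r. x \<in> M \<Longrightarrow> {y \<in> M. d x y < r} \<in> sets N"
    and sub: "sets N \<subseteq> sets (sigma M {U. openin (Metric_space.mtopology M d) U})"
  shows "sets N = sets (sigma M {U. openin (Metric_space.mtopology M d) U})"
proof
  interpret Metric_space M d by fact
  have "U \<in> sets N" if U: "openin mtopology U" for U
  proof -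
    define \<B> where "\<B> = {mball y (of_rat q) |y q. y \<in> C \<and> mball y (of_rat q) \<subseteq> U}"
    have "\<B> \<subseteq> (\<lambda>(y, q). mball y (of_rat q)) ` (C \<times> UNIV)" by (auto simp: \<B>_def)
    then have "countable \<B>" by (rule countable_subset) (auto intro: countable)
    moreover have "mball y r \<in> sets N" for y r
      using balls[of y r] by (cases "y \<in> M") (auto simp: mball_def)
    then have "\<B> \<subseteq> sets N" by (auto simp: \<B>_def)
    ultimately have "\<Union>\<B> \<in> sets N" by auto
    then show ?thesis using openin_mtopology_countable_Union_mball[OF U dense] by (simp add: \<B>_def)
  qed
  then have "sigma_sets (space N) {U. openin mtopology U} \<subseteq> sets N"
    by (intro sets.sigma_sets_subset) auto
  moreover have "sets (sigma M {U. openin mtopology U}) = sigma_sets M {U. openin mtopology U}"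
    by (rule sets_measure_of[OF openin_subset_Pow])
  ultimately show "sets (sigma M {U. openin mtopology U}) \<subseteq> sets N"
    by (simp add: spc)
qed fact

section \<open>Euclidean space with a rescaled distance\<close>

context
  fixes n :: nat and c :: real
  assumes c: "0 < c"
begin

abbreviation (input) "L2_carrier \<equiv> {..<n} \<rightarrow>\<^sub>E (UNIV :: real set)"
abbreviation (input) "L2_dist \<equiv> \<lambda>x y. c * L2_set (\<lambda>i. x i - y i) {..<n}"

lemma Metric_space_L2: "Metric_space L2_carrier L2_dist"
proof
  show "0 \<le> c * L2_set (\<lambda>i. x i - y i) {..<n}" for x y using c by simp
  show "c * L2_set (\<lambda>i. x i - y i) {..<n} = c * L2_set (\<lambda>i. y i - x i) {..<n}" for x y
    unfolding L2_set_def by (intro arg_cong[where f="\<lambda>s. c * sqrt s"] sum.cong refl power2_commute)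
  show "c * L2_set (\<lambda>i. x i - y i) {..<n} = 0 \<longleftrightarrow> x = y" if "x \<in> L2_carrier" "y \<in> L2_carrier" for x y
    using c that by (auto simp: L2_set_eq_0_iff intro: PiE_ext)
  show "c * L2_set (\<lambda>i. x i - z i) {..<n} \<le> c * L2_set (\<lambda>i. x i - y i) {..<n} + c * L2_set (\<lambda>i. y i - z i) {..<n}" for x y z
    using L2_set_triangle_ineq[of "\<lambda>i. x i - y i" "\<lambda>i. y i - z i" "{..<n}"] c
    by (simp add: distrib_left[symmetric])
qed

lemma component_le_L2_dist: "i < n \<Longrightarrow> c * \<bar>x i - y i\<bar> \<le> c * L2_set (\<lambda>i. x i - y i) {..<n}"
  using c member_le_L2_set[of "{..<n}" i "\<lambda>i. \<bar>x i - y i\<bar>"] by (simp add: L2_set_def)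

lemma L2_dense:
  "Metric_space.mtopology L2_carrier L2_dist closure_of ({..<n} \<rightarrow>\<^sub>E \<rat>) = L2_carrier"
proof -
  interpret Metric_space "L2_carrier" "L2_dist" by (rule Metric_space_L2)
  have "\<exists>y\<in>{..<n} \<rightarrow>\<^sub>E \<rat>. y \<in> mball x r" if x: "x \<in> L2_carrier" and r: "0 < r" for x r
  proof -
    \<comment> \<open>The Euclidean distance is at most the sum of the \<open>n\<close> coordinate
      errors. Dividing by \<open>n + 1\<close> makes the final inequality strict and also covers
      \<open>n = 0\<close>.\<close>
    define e where "e = r / (c * (n + 1))"
    have e: "e > 0" using c r by (simp add: e_def)
    have "\<exists>q\<in>\<rat>. x i < q \<and> q < x i + e" for i
      using Rats_dense_in_real[of "x i" "x i + e"] e by simp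
    then obtain q where q: "\<And>i. q i \<in> \<rat>" "\<And>i. x i < q i" "\<And>i. q i < x i + e" by metis
    define y where "y = restrict q {..<n}"
    have "L2_set (\<lambda>i. x i - y i) {..<n} \<le> (\<Sum>i<n. \<bar>x i - y i\<bar>)" by (rule L2_set_le_sum_abs)
    also have "\<dots> \<le> (\<Sum>i<n. e)"
    proof (intro sum_mono)
      fix i assume "i \<in> {..<n}" then show "\<bar>x i - y i\<bar> \<le> e" using q(2,3)[of i] by (simp add: y_def)
    qed
    also have "\<dots> < (n + 1) * e" using e by simp
    finally have "c * L2_set (\<lambda>i. x i - y i) {..<n} < c * ((n + 1) * e)" using c by simp
    also have "\<dots> = r" using c by (simp add: e_def)
    finally show ?thesis using x q(1) by (intro bexI[of _ y]) (auto simp: y_def)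
  qed
  then show ?thesis unfolding metric_closure_of by auto
qed

lemma L2_mcomplete: "Metric_space.mcomplete L2_carrier L2_dist"
proof -
  interpret Metric_space "L2_carrier" "L2_dist" by (rule Metric_space_L2)
  have "\<exists>x. limitin mtopology \<sigma> x sequentially" if \<sigma>: "MCauchy \<sigma>" for \<sigma>
  proof -
    have \<sigma>M: "\<sigma> k \<in> L2_carrier" for k using \<sigma> by (auto simp: MCauchy_def)
    have "convergent (\<lambda>k. \<sigma> k i)" if i: "i < n" for i
      unfolding Cauchy_convergent_iff[symmetric]
    proof (rule metric_CauchyI)
      fix e :: real assume "0 < e"
      then have "0 < c * e" using c by simp
      then obtain N where N: "\<And>k l. N \<le> k \<Longrightarrow> N \<le> l \<Longrightarrow> c * L2_set (\<lambda>i. \<sigma> k i - \<sigma> l i) {..<n} < c * e"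
        using \<sigma> unfolding MCauchy_def by blast
      have "dist (\<sigma> k i) (\<sigma> l i) < e" if "N \<le> k" "N \<le> l" for k l
        using le_less_trans[OF component_le_L2_dist[OF i] N[OF that]] c by (simp add: dist_real_def)
      then show "\<exists>N. \<forall>k\<ge>N. \<forall>l\<ge>N. dist (\<sigma> k i) (\<sigma> l i) < e" by blast
    qed
    then obtain l where l: "\<And>i. i < n \<Longrightarrow> (\<lambda>k. \<sigma> k i) \<longlonglongrightarrow> l i"
      unfolding convergent_def by metis
    define x where "x = restrict l {..<n}"
    have "(\<lambda>k. c * L2_set (\<lambda>i. \<sigma> k i - x i) {..<n}) \<longlonglongrightarrow> c * sqrt (\<Sum>i<n. (x i - x i)\<^sup>2)"
      unfolding L2_set_def by (intro tendsto_intros) (auto simp: x_def l)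
    then have "(\<lambda>k. c * L2_set (\<lambda>i. \<sigma> k i - x i) {..<n}) \<longlonglongrightarrow> 0" by simp
    moreover have "x \<in> L2_carrier" by (simp add: x_def)
    ultimately have "limitin mtopology \<sigma> x sequentially"
      using \<sigma>M by (simp add: limitin_metric_dist_null)
    then show ?thesis by blast
  qed
  then show ?thesis by (auto simp: mcomplete_def)
qed

text \<open>Balls belong to the product sigma-algebra because the norm is a measurable function of
  the coordinates. Conversely, coordinate projections are continuous for the distance, hence
  Borel.\<close>

lemma sets_PiM_lborel_L2:
  "sets (\<Pi>\<^sub>M i\<in>{..<n}. lborel) = sets (sigma L2_carrier {U. openin (Metric_space.mtopology L2_carrier L2_dist) U})"
proof (rule sets_sigma_openin_eqI[OF Metric_space_L2 _ _ L2_dense])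
  interpret Metric_space "L2_carrier" "L2_dist" by (rule Metric_space_L2)
  show "countable ({..<n} \<rightarrow>\<^sub>E (\<rat> :: real set))" by (intro countable_PiE) (auto simp: countable_rat)
  show "space (\<Pi>\<^sub>M i\<in>{..<n}. lborel :: real measure) = L2_carrier" by (simp add: space_PiM)
  show "{y \<in> L2_carrier. c * L2_set (\<lambda>i. x i - y i) {..<n} < r} \<in> sets (\<Pi>\<^sub>M i\<in>{..<n}. lborel)" for x r
  proof -
    have "{y \<in> space (\<Pi>\<^sub>M i\<in>{..<n}. lborel). c * L2_set (\<lambda>i. x i - y i) {..<n} < r} \<in> sets (\<Pi>\<^sub>M i\<in>{..<n}. lborel)"
      unfolding L2_set_def by measurable
    then show ?thesis by (simp add: space_PiM)
  qed
  let ?S = "sigma L2_carrier {U. openin mtopology U}"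
  have spc: "space ?S = L2_carrier" by (simp add: space_measure_of_conv)
  have sets: "U \<in> sets ?S" if "openin mtopology U" for U
    using that by (intro in_measure_of[OF openin_subset_Pow]) simp
  show "sets (\<Pi>\<^sub>M i\<in>{..<n}. lborel) \<subseteq> sets ?S"
  proof (rule sets_PiM_in_sets)
    show "space ?S = (\<Pi>\<^sub>E i\<in>{..<n}. space lborel)" by (simp add: spc)
    fix i :: nat and A :: "real set" assume i: "i \<in> {..<n}" and A: "A \<in> sets lborel"
    have "(\<lambda>x. x i) \<in> borel_measurable ?S"
    proof (rule borel_measurableI)
      fix T :: "real set" assume T: "open T"
      have "openin mtopology {x \<in> L2_carrier. x i \<in> T}"
        unfolding openin_mtopology
      proof (intro conjI allI impI)
        fix x assume x: "x \<in> {x \<in> L2_carrier. x i \<in> T}"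
        then obtain e where e: "e > 0" "ball (x i) e \<subseteq> T" using T unfolding open_contains_ball by blast
        have "mball x (c * e) \<subseteq> {x \<in> L2_carrier. x i \<in> T}"
        proof
          fix y assume y: "y \<in> mball x (c * e)"
          then have "c * \<bar>x i - y i\<bar> < c * e"
            using component_le_L2_dist[of i x y] i by auto
          then have "y i \<in> ball (x i) e" using c by (simp add: dist_real_def)
          then show "y \<in> {x \<in> L2_carrier. x i \<in> T}" using e y by auto
        qed
        then show "\<exists>r>0. mball x r \<subseteq> {x \<in> L2_carrier. x i \<in> T}" using c e by (intro exI[of _ "c * e"]) auto
      qed auto
      from sets[OF this] show "(\<lambda>x. x i) -` T \<inter> space ?S \<in> sets ?S"
        unfolding spc by (simp add: vimage_def Int_def conj_commute)
    qed
    from measurable_sets[OF this, of A] A show "{x \<in> space ?S. x i \<in> A} \<in> sets ?S"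
      by (simp add: vimage_def Int_def conj_commute)
  qed
qed

lemma mm_space_L2:
  assumes X: "mm_carrier X = L2_carrier" "mm_dist X = L2_dist"
    and m: "sets (mm_measure X) = sets (\<Pi>\<^sub>M i\<in>{..<n}. lborel)" "prob_space (mm_measure X)"
  shows "mm_space X"
  unfolding mm_space_def mm_topology_def X
proof (intro conjI)
  interpret Metric_space "L2_carrier" "L2_dist" by (rule Metric_space_L2)
  have "countable ({..<n} \<rightarrow>\<^sub>E (\<rat> :: real set))" by (intro countable_PiE) (auto simp: countable_rat)
  then show "separable_space mtopology"
    unfolding separable_space_def using L2_dense by (intro exI[of _ "{..<n} \<rightarrow>\<^sub>E \<rat>"]) auto
  show "sets (mm_measure X) = sets (sigma L2_carrier {U. openin mtopology U})"
    unfolding m by (rule sets_PiM_lborel_L2)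
qed (fact Metric_space_L2 L2_mcomplete m)+

lemma Lipschitz_L2_measurable:
  assumes lip: "\<And>x y. x \<in> L2_carrier \<Longrightarrow> y \<in> L2_carrier \<Longrightarrow> \<bar>f x - f y\<bar> \<le> L2_dist x y"
  shows "f \<in> borel_measurable (\<Pi>\<^sub>M i\<in>{..<n}. lborel)"
proof (rule borel_measurableI)
  interpret Metric_space "L2_carrier" "L2_dist" by (rule Metric_space_L2)
  fix T :: "real set" assume T: "open T"
  have "openin mtopology {x \<in> L2_carrier. f x \<in> T}"
    unfolding openin_mtopology
  proof (intro conjI allI impI)
    fix x assume x: "x \<in> {x \<in> L2_carrier. f x \<in> T}"
    then obtain e where e: "e > 0" "ball (f x) e \<subseteq> T" using T unfolding open_contains_ball by blast
    have "mball x e \<subseteq> {x \<in> L2_carrier. f x \<in> T}"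
    proof
      fix y assume y: "y \<in> mball x e"
      then have "f y \<in> ball (f x) e"
        using lip[of x y] by (auto simp: dist_real_def)
      then show "y \<in> {x \<in> L2_carrier. f x \<in> T}" using e y by auto
    qed
    then show "\<exists>r>0. mball x r \<subseteq> {x \<in> L2_carrier. f x \<in> T}" using e by blast
  qed auto
  then have "{x \<in> L2_carrier. f x \<in> T} \<in> sets (sigma L2_carrier {U. openin mtopology U})"
    by (intro in_measure_of[OF openin_subset_Pow]) simp
  then show "f -` T \<inter> space (\<Pi>\<^sub>M i\<in>{..<n}. lborel) \<in> sets (\<Pi>\<^sub>M i\<in>{..<n}. lborel)"
    unfolding sets_PiM_lborel_L2 by (simp add: space_PiM vimage_def Int_def conj_commute)
qed

end

section \<open>The half line as a closed subspace of the real line\<close>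

lemma mm_space_half_line:
  assumes prob: "prob_space (mm_measure (half_line_space \<beta>))"
  shows "mm_space (half_line_space \<beta>)"
proof -
  have d: "(\<lambda>s t. \<bar>s - t\<bar>) = (dist :: real \<Rightarrow> real \<Rightarrow> real)"
    by (simp add: fun_eq_iff dist_real_def)
  interpret S: Submetric UNIV "dist :: real \<Rightarrow> real \<Rightarrow> real" "{0..}"
    by unfold_locales simp
  have top: "S.sub.mtopology = top_of_set {0..}" by (simp add: S.mtopology_submetric)
  have comp: "S.sub.mcomplete"
    using S.closedin_eq_mcomplete by (simp add: complete_UNIV)
  have "S.sub.mtopology closure_of (\<rat> \<inter> {0..}) = {0..}"
  proof -
    have "\<exists>y\<in>\<rat> \<inter> {0..}. y \<in> S.sub.mball x r" if "0 \<le> x" "0 < r" for x r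
      using Rats_dense_in_real[of x "x + r"] that by (force simp: dist_real_def)
    then show ?thesis unfolding S.sub.metric_closure_of by auto
  qed
  then have sep: "separable_space S.sub.mtopology"
    unfolding separable_space_def by (intro exI[of _ "\<rat> \<inter> {0..}"]) (auto intro: countable_subset[OF _ countable_rat])
  \<comment> \<open>The trace of a generated sigma-algebra on \<open>{0..}\<close> is generated by
    the traces of its generators, and the traces of open sets are the relatively open sets.\<close>
  have "sets (mm_measure (half_line_space \<beta>)) = (\<inter>) {0..} ` sigma_sets UNIV {U. open U}"
    by (simp add: half_line_space_def sets_restrict_space borel_def)
  also have "\<dots> = sigma_sets {0..} ((\<inter>) {0..} ` {U :: real set. open U})"
  proof (rule sigma_sets_Int)
    have "{0::real..} \<in> sets borel" by simp
    then show "{0::real..} \<in> sigma_sets UNIV {U. open U}" by (simp add: borel_def)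
  qed simp
  also have "(\<inter>) {0..} ` {U :: real set. open U} = {U. openin (top_of_set {0..}) U}"
    by (auto simp: openin_open)
  also have "sigma_sets {0..} {U. openin (top_of_set {0::real..}) U} = sets (sigma {0..} {U. openin (top_of_set {0..}) U})"
    by (rule sets_measure_of[symmetric]) (auto dest: openin_imp_subset)
  finally have sets: "sets (mm_measure (half_line_space \<beta>)) = sets (sigma {0..} {U. openin (top_of_set {0..}) U})" .
  show ?thesis
    using prob S.sub.Metric_space_axioms comp sep sets
    by (simp add: mm_space_def mm_topology_def half_line_space_def d top)
qed

section \<open>The Cauchy measure as a Gaussian mixture\<close>

text \<open>The substitution \<open>u = a / (2 * t^2)\<close>, a decreasing bijection of the
  positive half line, turns Euler's integral for \<open>Gamma (m / 2)\<close> into the left side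
  times \<open>2 * (a / 2) powr (m / 2)\<close>.\<close>

lemma nn_integral_inverse_gamma:
  fixes m a :: real
  assumes m: "0 < m" and a: "0 < a"
  shows "(\<integral>\<^sup>+t. ennreal (indicator {0<..} t * (t powr (- m - 1) * exp (- a / (2 * t\<^sup>2)))) \<partial>lborel) =
    ennreal (1/2 * (a / 2) powr (- m / 2) * Gamma (m / 2))"
proof -
  define g where "g t = a / (2 * t\<^sup>2)" for t :: real
  define g' where "g' t = - a / t ^ 3" for t :: real
  define f where "f u = u powr (m/2 - 1) / exp u" for u :: real
  define w where "w t = t powr (- m - 1) * exp (- a / (2 * t\<^sup>2))" for t :: real
  have img: "g ` {0<..} = {0<..}"
  proof safe
    fix u :: real assume u: "u > 0"
    show "u \<in> g ` {0<..}"
      by (rule image_eqI[of _ _ "sqrt (a / (2 * u))"]) (use u a in \<open>auto simp: g_def\<close>)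
  qed (use a in \<open>auto simp: g_def\<close>)
  have inj: "inj_on g {0<..}"
    using a by (auto intro!: inj_onI simp: g_def power2_eq_iff field_simps)
  have der: "(g has_real_derivative g' t) (at t within {0<..})" if "t \<in> {0<..}" for t
    using that unfolding g_def g'_def
    by (auto intro!: derivative_eq_intros simp: power2_eq_square power3_eq_cube field_simps)
  have f0: "(f has_integral Gamma (m/2)) {0..}"
    unfolding f_def using m by (intro Gamma_integral_real) auto
  have "(f has_integral Gamma (m/2)) {0<..}"
    by (rule has_integral_spike_set_eq[THEN iffD1, OF _ _ f0])
       (auto intro: negligible_subset[of "{0}"])
  then have "f absolutely_integrable_on {0<..}" "integral {0<..} f = Gamma (m/2)"
    by (auto simp: has_integral_iff f_def intro!: nonnegative_absolutely_integrable_1)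
  then have *: "(\<lambda>t. \<bar>g' t\<bar> * f (g t)) absolutely_integrable_on {0<..}"
      "integral {0<..} (\<lambda>t. \<bar>g' t\<bar> * f (g t)) = Gamma (m/2)"
    using has_absolute_integral_change_of_variables_1'[OF _ der inj, of f "Gamma (m/2)"] by (auto simp: img)
  have eq: "\<bar>g' t\<bar> * f (g t) = 2 * (a/2) powr (m/2) * w t" if "t \<in> {0<..}" for t
  proof -
    have t: "t > 0" using that by simp
    have "g t powr (m/2 - 1) = (a/2) powr (m/2 - 1) * (t powr (-2)) powr (m/2 - 1)"
    proof -
      have "g t = (a/2) * t powr (-2)"
        using t by (simp add: g_def powr_minus powr_numeral divide_simps)
      then show ?thesis using a by (simp only: powr_mult)
    qed
    also have "(t powr (-2)) powr (m/2 - 1) = t powr (2 - m)"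
      by (simp add: powr_powr algebra_simps)
    also have "(a/2) powr (m/2 - 1) = (a/2) powr (m/2) / (a/2)"
      using a by (simp add: powr_diff)
    finally have g1: "g t powr (m/2 - 1) = (a/2) powr (m/2) / (a/2) * t powr (2 - m)" .
    have g2: "\<bar>g' t\<bar> = a * t powr (-3)"
      using t a by (simp add: g'_def powr_minus powr_numeral divide_simps)
    have g3: "t powr (-3) * t powr (2 - m) = t powr (- m - 1)"
    proof -
      have "-3 + (2 - m) = - m - 1" by simp
      then show ?thesis unfolding powr_add[symmetric] by (rule arg_cong)
    qed
    have "\<bar>g' t\<bar> * f (g t) = 2 * (a/2) powr (m/2) * (t powr (-3) * t powr (2 - m)) * exp (- g t)"
      using a unfolding f_def g1 g2 by (simp add: exp_minus field_simps)
    then show ?thesis unfolding g3 by (simp add: w_def g_def)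
  qed
  have w: "((\<lambda>t. 2 * (a/2) powr (m/2) * w t) has_integral Gamma (m/2)) {0<..}"
    using * eq has_integral_cong[of "{0<..}" "\<lambda>t. \<bar>g' t\<bar> * f (g t)" "\<lambda>t. 2 * (a/2) powr (m/2) * w t"]
    by (auto simp: has_integral_iff absolutely_integrable_on_def)
  have c: "2 * (a/2) powr (m/2) > 0" using a by simp
  have "(w has_integral (Gamma (m/2) / (2 * (a/2) powr (m/2)))) {0<..}"
    using has_integral_mult_right[OF w, of "1 / (2 * (a/2) powr (m/2))"] c by (simp add: field_simps)
  also have "Gamma (m/2) / (2 * (a/2) powr (m/2)) = 1/2 * (a / 2) powr (- m / 2) * Gamma (m / 2)"
    by (simp add: powr_minus field_simps)
  finally have "(\<integral>\<^sup>+t. ennreal (indicator {0<..} t * w t) \<partial>lborel) = ennreal (1/2 * (a / 2) powr (- m / 2) * Gamma (m / 2))"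
  proof (intro nn_integral_has_integral_lborel)
    assume w: "(w has_integral (1/2 * (a / 2) powr (- m / 2) * Gamma (m / 2))) {0<..}"
    have "(\<lambda>t. indicator {0<..} t * w t) = (\<lambda>t. if t \<in> {0<..} then w t else 0)"
      by (auto simp: indicator_def)
    then show "((\<lambda>t. indicator {0<..} t * w t) has_integral (1/2 * (a / 2) powr (- m / 2) * Gamma (m / 2))) UNIV"
      using w by (simp only: has_integral_restrict_UNIV)
  qed (auto simp: w_def)
  then show ?thesis by (simp add: w_def)
qed

section \<open>Integrals against the law of \<open>T\<close>\<close>

lemma half_line_density_eq:
  "half_line_density \<beta> t = 2 powr (1 - \<beta> / 2) / Gamma (\<beta> / 2) * (t powr (- \<beta> - 1) * exp (- 1 / (2 * t\<^sup>2)))"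
proof -
  have "1 / t powr (\<beta> + 1) = t powr (- (\<beta> + 1))" by (rule powr_minus_divide[symmetric])
  moreover have "- (\<beta> + 1) = - \<beta> - 1" by simp
  ultimately have "1 / t powr (\<beta> + 1) = t powr (- \<beta> - 1)" by simp
  then show ?thesis by (simp add: half_line_density_def)
qed

lemma half_line_density_nonneg: "0 < \<beta> \<Longrightarrow> 0 \<le> half_line_density \<beta> t"
  by (simp add: half_line_density_def Gamma_real_nonneg)

lemma borel_measurable_half_line_density [measurable]: "half_line_density \<beta> \<in> borel_measurable borel"
  unfolding half_line_density_def by measurable

abbreviation half_line_measure :: "real \<Rightarrow> real measure" where
  "half_line_measure \<beta> \<equiv> mm_measure (half_line_space \<beta>)"

lemma space_half_line_measure: "space (half_line_measure \<beta>) = {0..}"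
  by (simp add: half_line_space_def space_restrict_space)

lemma sets_half_line_measure [measurable_cong]: "sets (half_line_measure \<beta>) = sets (restrict_space borel {0..})"
  by (simp add: half_line_space_def sets_restrict_space)

text \<open>The null set \<open>{0}\<close> is discarded here because the Gaussian density with
  standard deviation \<open>t\<close> is available only for \<open>t > 0\<close>.\<close>

lemma nn_integral_half_line_measure:
  assumes \<beta>: "0 < \<beta>" and [measurable]: "u \<in> borel_measurable (half_line_measure \<beta>)"
  shows "integral\<^sup>N (half_line_measure \<beta>) u =
    (\<integral>\<^sup>+t. ennreal (half_line_density \<beta> t) * (u t * indicator {0<..} t) \<partial>lborel)"
proof -
  have [measurable]: "half_line_density \<beta> \<in> borel_measurable (restrict_space lborel {0..})"
    by (intro measurable_restrict_space1) simp
  have [measurable]: "u \<in> borel_measurable (restrict_space lborel {0..})"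
    using assms(2) by (simp add: half_line_space_def)
  have "integral\<^sup>N (half_line_measure \<beta>) u = (\<integral>\<^sup>+t. ennreal (half_line_density \<beta> t) * u t \<partial>restrict_space lborel {0..})"
    by (simp add: half_line_space_def nn_integral_density)
  also have "\<dots> = (\<integral>\<^sup>+t. ennreal (half_line_density \<beta> t) * u t * indicator {0..} t \<partial>lborel)"
    by (rule nn_integral_restrict_space) simp
  also have "\<dots> = (\<integral>\<^sup>+t. ennreal (half_line_density \<beta> t) * (u t * indicator {0<..} t) \<partial>lborel)"
    using AE_lborel_singleton[of 0] by (intro nn_integral_cong_AE) (auto simp: indicator_def elim: eventually_mono)
  finally show ?thesis .
qed

text \<open>For \<open>a = 1 + \<parallel>x\<parallel>^2\<close> this is, up to the factor
  \<open>(2 * pi) powr (- n / 2)\<close>, the density of \<open>T G\<close> at \<open>x\<close>: the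
  1 in \<open>a\<close> comes from the exponent of the half-line density, the square of the norm
  from the Gaussian exponent.\<close>

lemma nn_integral_half_line_density_weighted:
  assumes \<beta>: "0 < \<beta>" and a: "0 < a" and m: "m = real n + \<beta>"
  shows "(\<integral>\<^sup>+t. ennreal (half_line_density \<beta> t) * (ennreal (t powr (- real n) * exp (- (a - 1) / (2 * t\<^sup>2))) * indicator {0<..} t) \<partial>lborel) =
    ennreal (2 powr (real n / 2) * Gamma (m / 2) / Gamma (\<beta> / 2) / a powr (m / 2))"
proof -
  define C where "C = 2 powr (1 - \<beta> / 2) / Gamma (\<beta> / 2)"
  have C: "0 \<le> C" using \<beta> by (simp add: C_def Gamma_real_nonneg)
  have "ennreal (half_line_density \<beta> t) * (ennreal (t powr (- real n) * exp (- (a - 1) / (2 * t\<^sup>2))) * indicator {0<..} t) =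
      ennreal C * ennreal (indicator {0<..} t * (t powr (- m - 1) * exp (- a / (2 * t\<^sup>2))))" for t
  proof (cases "0 < t")
    case True
    have e: "exp (- 1 / (2 * t\<^sup>2)) * exp (- (a - 1) / (2 * t\<^sup>2)) = exp (- a / (2 * t\<^sup>2))"
      by (simp add: exp_add[symmetric] diff_divide_distrib)
    have p: "t powr (- \<beta> - 1) * t powr (- real n) = t powr (- m - 1)"
    proof -
      have "(- \<beta> - 1) + (- real n) = - m - 1" by (simp add: m)
      then show ?thesis unfolding powr_add[symmetric] by (rule arg_cong)
    qed
    have "half_line_density \<beta> t * (t powr (- real n) * exp (- (a - 1) / (2 * t\<^sup>2))) =
      C * ((t powr (- \<beta> - 1) * t powr (- real n)) * (exp (- 1 / (2 * t\<^sup>2)) * exp (- (a - 1) / (2 * t\<^sup>2))))"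
      by (simp only: half_line_density_eq C_def[symmetric] mult_ac)
    also have "\<dots> = C * (t powr (- m - 1) * exp (- a / (2 * t\<^sup>2)))"
      unfolding e p ..
    finally show ?thesis
      using True C half_line_density_nonneg[OF \<beta>, of t] by (simp add: ennreal_mult[symmetric])
  qed simp
  then have "(\<integral>\<^sup>+t. ennreal (half_line_density \<beta> t) * (ennreal (t powr (- real n) * exp (- (a - 1) / (2 * t\<^sup>2))) * indicator {0<..} t) \<partial>lborel) =
     ennreal C * (\<integral>\<^sup>+t. ennreal (indicator {0<..} t * (t powr (- m - 1) * exp (- a / (2 * t\<^sup>2)))) \<partial>lborel)"
    by (simp add: nn_integral_cmult)
  also have "\<dots> = ennreal C * ennreal (1/2 * (a / 2) powr (- m / 2) * Gamma (m / 2))"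
    using \<beta> a by (subst nn_integral_inverse_gamma) (auto simp: m)
  also have "\<dots> = ennreal (C * (1/2 * (a / 2) powr (- m / 2) * Gamma (m / 2)))"
    using C by (rule ennreal_mult'[symmetric])
  also have "C * (1/2 * (a / 2) powr (- m / 2) * Gamma (m / 2)) =
      2 powr (real n / 2) * Gamma (m / 2) / Gamma (\<beta> / 2) / a powr (m / 2)"
  proof -
    have "(a / 2) powr (- m / 2) = 2 powr (m / 2) / a powr (m / 2)"
      using a by (simp add: powr_divide powr_minus_divide)
    moreover have "2 powr (1 - \<beta> / 2) * 2 powr (m / 2) = 2 * 2 powr (real n / 2)"
    proof -
      have "2 powr (1 - \<beta> / 2) * 2 powr (m / 2) = 2 powr (1 + real n / 2)"
        by (simp add: powr_add[symmetric] m add_divide_distrib)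
      then show ?thesis by (simp add: powr_add)
    qed
    ultimately show ?thesis by (simp add: C_def field_simps)
  qed
  finally show ?thesis .
qed

lemma prob_space_half_line_measure:
  assumes \<beta>: "0 < \<beta>"
  shows "prob_space (half_line_measure \<beta>)"
proof
  have G: "Gamma (\<beta> / 2) \<noteq> 0" using \<beta> by (intro less_imp_neq[symmetric] Gamma_real_pos) simp
  have "emeasure (half_line_measure \<beta>) (space (half_line_measure \<beta>)) = (\<integral>\<^sup>+t. 1 \<partial>half_line_measure \<beta>)"
    by simp
  also have "\<dots> = (\<integral>\<^sup>+t. ennreal (half_line_density \<beta> t) * (1 * indicator {0<..} t) \<partial>lborel)"
    by (rule nn_integral_half_line_measure[OF \<beta>]) simp
  \<comment> \<open>The total mass is the weighted integral in dimension 0 with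
    \<open>a = 1\<close>.\<close>
  also have "\<dots> = (\<integral>\<^sup>+t. ennreal (half_line_density \<beta> t) * (ennreal (t powr (- real 0) * exp (- (1 - 1) / (2 * t\<^sup>2))) * indicator {0<..} t) \<partial>lborel)"
    by (intro nn_integral_cong) (auto simp: indicator_def)
  also have "\<dots> = 1"
    using \<beta> G by (subst nn_integral_half_line_density_weighted[where m=\<beta>]) auto
  finally show "emeasure (half_line_measure \<beta>) (space (half_line_measure \<beta>)) = 1" .
qed

lemma prod_normal_density:
  assumes t: "0 < t"
  shows "(\<Prod>i<n. normal_density 0 t (x i)) =
    (2 * pi) powr (- real n / 2) * (t powr (- real n) * exp (- (L2_set x {..<n})\<^sup>2 / (2 * t\<^sup>2)))"
proof -
  have "sqrt (2 * pi * t\<^sup>2) = (2 * pi) powr (1/2) * t"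
    using t by (simp add: real_sqrt_mult powr_half_sqrt)
  then have "(1 / sqrt (2 * pi * t\<^sup>2)) ^ n = ((2 * pi) powr (1/2)) powr (- real n) * t powr (- real n)"
    using t by (simp add: powr_realpow powr_minus_divide power_mult_distrib power_divide)
  moreover have "(\<Prod>i<n. normal_density 0 t (x i)) = (1 / sqrt (2 * pi * t\<^sup>2)) ^ n * exp (- (L2_set x {..<n})\<^sup>2 / (2 * t\<^sup>2))"
  proof -
    have "(\<Prod>i<n. normal_density 0 t (x i)) = (\<Prod>i<n. 1 / sqrt (2 * pi * t\<^sup>2) * exp (- (x i)\<^sup>2 / (2 * t\<^sup>2)))"
      by (simp add: normal_density_def)
    also have "\<dots> = (1 / sqrt (2 * pi * t\<^sup>2)) ^ n * exp (\<Sum>i<n. - (x i)\<^sup>2 / (2 * t\<^sup>2))"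
      by (simp only: prod.distrib prod_constant exp_sum[OF finite_lessThan] card_lessThan)
    also have "(\<Sum>i<n. - (x i)\<^sup>2 / (2 * t\<^sup>2)) = - (L2_set x {..<n})\<^sup>2 / (2 * t\<^sup>2)"
      by (simp add: L2_set_square sum_negf sum_divide_distrib)
    finally show ?thesis .
  qed
  ultimately show ?thesis by (simp add: powr_powr)
qed

lemma borel_measurable_cauchy_density [measurable]:
  "cauchy_density n \<beta> \<in> borel_measurable (\<Pi>\<^sub>M i\<in>{..<n}. lborel)"
  unfolding cauchy_density_def by measurable

lemma sets_cauchy_measure [measurable_cong]:
  "sets (mm_measure (cauchy_space n \<beta>)) = sets (\<Pi>\<^sub>M i\<in>{..<n}. lborel)"
  by (simp add: cauchy_space_def)

lemma borel_measurable_half_line_id: "(\<lambda>t. t) \<in> borel_measurable (half_line_measure \<beta>)"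
  by (subst measurable_cong_sets[OF sets_half_line_measure refl]) (rule measurable_restrict_space1, simp)

lemma measurable_gauss_component:
  assumes "i < n"
  shows "(\<lambda>g. g i) \<in> borel_measurable (gauss n)"
proof -
  have "(\<lambda>g. g i) \<in> (\<Pi>\<^sub>M i\<in>{..<n}. lborel) \<rightarrow>\<^sub>M (lborel :: real measure)"
    by (rule measurable_component_singleton) (use assms in simp)
  then show ?thesis by (subst measurable_cong_sets[OF sets_gauss refl]) simp
qed

lemma measurable_scale_pair [measurable]:
  "(\<lambda>(g, t). \<lambda>i\<in>{..<n}. t * g i) \<in> gauss n \<Otimes>\<^sub>M half_line_measure \<beta> \<rightarrow>\<^sub>M (\<Pi>\<^sub>M i\<in>{..<n}. lborel)"
proof -
  have [measurable]: "(\<lambda>z. snd z) \<in> borel_measurable (gauss n \<Otimes>\<^sub>M half_line_measure \<beta>)"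
    by (rule measurable_compose[OF measurable_snd borel_measurable_half_line_id])
  have "(\<lambda>z. fst z i) \<in> borel_measurable (gauss n \<Otimes>\<^sub>M half_line_measure \<beta>)" if "i \<in> {..<n}" for i
  proof -
    have "(\<lambda>g. g i) \<in> borel_measurable (gauss n)"
      by (rule measurable_gauss_component) (use that in simp)
    from measurable_compose[OF measurable_fst this] show ?thesis .
  qed
  then show ?thesis
    unfolding split_beta by (intro measurable_restrict) measurable
qed

text \<open>Given \<open>T = t\<close> with \<open>t > 0\<close>, the scaled vector has a centred
  Gaussian density. Tonelli exchanges the integrals over \<open>t\<close> and \<open>x\<close>, and
  the inner integral over \<open>t\<close> at a fixed \<open>x\<close> is then an inverse gamma
  integral whose value is the Cauchy density.\<close>

theorem cauchy_measure_eq_distr: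
  assumes \<beta>: "0 < \<beta>"
  shows "distr (gauss n \<Otimes>\<^sub>M half_line_measure \<beta>) (\<Pi>\<^sub>M i\<in>{..<n}. lborel) (\<lambda>(g, t). \<lambda>i\<in>{..<n}. t * g i) =
    mm_measure (cauchy_space n \<beta>)"
proof (rule measure_eqI)
  let ?L = "\<Pi>\<^sub>M i\<in>{..<n}. lborel :: real measure"
  interpret gauss: prob_space "gauss n" by (rule prob_space_gauss)
  interpret nu: prob_space "half_line_measure \<beta>" by (rule prob_space_half_line_measure[OF \<beta>])
  interpret pair_sigma_finite "gauss n" "half_line_measure \<beta>" ..
  interpret product_sigma_finite "\<lambda>_::nat. lborel :: real measure" ..
  interpret L: sigma_finite_measure ?L by (rule sigma_finite) simp
  interpret LL: pair_sigma_finite ?L "lborel :: real measure" ..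
  show "sets (distr (gauss n \<Otimes>\<^sub>M half_line_measure \<beta>) ?L (\<lambda>(g, t). \<lambda>i\<in>{..<n}. t * g i)) =
    sets (mm_measure (cauchy_space n \<beta>))" by (simp add: sets_cauchy_measure)
  fix A assume "A \<in> sets (distr (gauss n \<Otimes>\<^sub>M half_line_measure \<beta>) ?L (\<lambda>(g, t). \<lambda>i\<in>{..<n}. t * g i))"
  then have [measurable]: "A \<in> sets ?L" by simp
  define P where "P x t = t powr (- real n) * exp (- (L2_set x {..<n})\<^sup>2 / (2 * t\<^sup>2))" for x and t :: real
  define c where "c = (2 * pi) powr (- real n / 2)"
  have [measurable]: "(\<lambda>(x, t). P x t) \<in> borel_measurable (?L \<Otimes>\<^sub>M lborel)"
    unfolding P_def by measurable
  have P0: "0 \<le> P x t" for x t by (simp add: P_def)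
  have c0: "0 \<le> c" by (simp add: c_def)
  have m[measurable]: "(\<lambda>z. indicator A (case z of (g, t) \<Rightarrow> \<lambda>i\<in>{..<n}. t * g i) :: ennreal)
      \<in> borel_measurable (gauss n \<Otimes>\<^sub>M half_line_measure \<beta>)"
    by (rule measurable_compose[OF measurable_scale_pair]) simp
  have scale: "(\<integral>\<^sup>+g. indicator A (\<lambda>i\<in>{..<n}. t * g i) \<partial>gauss n) = (\<integral>\<^sup>+x. ennreal (c * P x t) * indicator A x \<partial>?L)"
    if t: "0 < t" for t
  proof -
    have "(\<integral>\<^sup>+g. indicator A (\<lambda>i\<in>{..<n}. t * g i) \<partial>gauss n) =
      (\<integral>\<^sup>+x. indicator A x \<partial>distr (gauss n) ?L (\<lambda>g. \<lambda>i\<in>{..<n}. t * g i))"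
    proof (rule nn_integral_distr[symmetric])
      have "(\<lambda>g. g i) \<in> borel_measurable (gauss n)" if "i \<in> {..<n}" for i
        by (rule measurable_gauss_component) (use that in simp)
      then show "(\<lambda>g. \<lambda>i\<in>{..<n}. t * g i) \<in> gauss n \<rightarrow>\<^sub>M ?L"
        by (intro measurable_restrict) simp
    qed auto
    also have "\<dots> = (\<integral>\<^sup>+x. ennreal (\<Prod>i<n. normal_density 0 t (x i)) * indicator A x \<partial>?L)"
      unfolding scale_gauss[OF t] by (rule nn_integral_density) measurable
    finally show ?thesis by (simp only: prod_normal_density[OF t] P_def c_def)
  qed
  have "emeasure (distr (gauss n \<Otimes>\<^sub>M half_line_measure \<beta>) ?L (\<lambda>(g, t). \<lambda>i\<in>{..<n}. t * g i)) A =
    (\<integral>\<^sup>+x. indicator A x \<partial>distr (gauss n \<Otimes>\<^sub>M half_line_measure \<beta>) ?L (\<lambda>(g, t). \<lambda>i\<in>{..<n}. t * g i))"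
    by simp
  also have "\<dots> = (\<integral>\<^sup>+z. indicator A (case z of (g, t) \<Rightarrow> \<lambda>i\<in>{..<n}. t * g i) \<partial>(gauss n \<Otimes>\<^sub>M half_line_measure \<beta>))"
    by (rule nn_integral_distr) auto
  also have "\<dots> = (\<integral>\<^sup>+t. \<integral>\<^sup>+g. indicator A (\<lambda>i\<in>{..<n}. t * g i) \<partial>gauss n \<partial>half_line_measure \<beta>)"
    using nn_integral_snd[OF m] by simp
  also have "\<dots> = (\<integral>\<^sup>+t. ennreal (half_line_density \<beta> t) *
      ((\<integral>\<^sup>+g. indicator A (\<lambda>i\<in>{..<n}. t * g i) \<partial>gauss n) * indicator {0<..} t) \<partial>lborel)"
    by (rule nn_integral_half_line_measure[OF \<beta>]) (use gauss.borel_measurable_nn_integral m in simp)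
  also have "\<dots> = (\<integral>\<^sup>+t. \<integral>\<^sup>+x. indicator A x * (ennreal c * (ennreal (half_line_density \<beta> t) * (ennreal (P x t) * indicator {0<..} t))) \<partial>?L \<partial>lborel)"
  proof (rule nn_integral_cong)
    fix t :: real
    show "ennreal (half_line_density \<beta> t) * ((\<integral>\<^sup>+g. indicator A (\<lambda>i\<in>{..<n}. t * g i) \<partial>gauss n) * indicator {0<..} t) =
      (\<integral>\<^sup>+x. indicator A x * (ennreal c * (ennreal (half_line_density \<beta> t) * (ennreal (P x t) * indicator {0<..} t))) \<partial>?L)"
    proof (cases "0 < t")
      case True
      have "(\<integral>\<^sup>+x. indicator A x * (ennreal c * (ennreal (half_line_density \<beta> t) * (ennreal (P x t) * indicator {0<..} t))) \<partial>?L) =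
        (\<integral>\<^sup>+x. ennreal (half_line_density \<beta> t) * (ennreal (c * P x t) * indicator A x) \<partial>?L)"
        using True by (intro nn_integral_cong) (simp add: ennreal_mult P0 c0 mult_ac)
      also have "\<dots> = ennreal (half_line_density \<beta> t) * (\<integral>\<^sup>+x. ennreal (c * P x t) * indicator A x \<partial>?L)"
        by (rule nn_integral_cmult) measurable
      finally show ?thesis using True by (simp add: scale)
    qed simp
  qed
  also have "\<dots> = (\<integral>\<^sup>+x. \<integral>\<^sup>+t. indicator A x * (ennreal c * (ennreal (half_line_density \<beta> t) * (ennreal (P x t) * indicator {0<..} t))) \<partial>lborel \<partial>?L)"
    by (rule LL.Fubini') measurable
  also have "\<dots> = (\<integral>\<^sup>+x. ennreal (cauchy_density n \<beta> x) * indicator A x \<partial>?L)"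
  proof (rule nn_integral_cong)
    fix x
    define a where "a = 1 + (L2_set x {..<n})\<^sup>2"
    have a: "0 < a" unfolding a_def by (simp add: add_pos_nonneg)
    have "(\<integral>\<^sup>+t. indicator A x * (ennreal c * (ennreal (half_line_density \<beta> t) * (ennreal (P x t) * indicator {0<..} t))) \<partial>lborel) =
       indicator A x * (ennreal c * (\<integral>\<^sup>+t. ennreal (half_line_density \<beta> t) * (ennreal (P x t) * indicator {0<..} t) \<partial>lborel))"
    proof -
      have [measurable]: "(\<lambda>t. P x t) \<in> borel_measurable borel" unfolding P_def by measurable
      show ?thesis by (simp add: nn_integral_cmult)
    qed
    also have "(\<integral>\<^sup>+t. ennreal (half_line_density \<beta> t) * (ennreal (P x t) * indicator {0<..} t) \<partial>lborel) =
      ennreal (2 powr (real n / 2) * Gamma ((real n + \<beta>) / 2) / Gamma (\<beta> / 2) / a powr ((real n + \<beta>) / 2))"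
      using nn_integral_half_line_density_weighted[OF \<beta> a refl, of n] by (simp add: P_def a_def)
    also have "ennreal c * \<dots> = ennreal (cauchy_density n \<beta> x)"
    proof -
      \<comment> \<open>The power of 2 in the Gaussian constant cancels the one from the inverse
        gamma integral, which leaves the factor \<open>pi powr (n / 2)\<close> in the denominator of
        the Cauchy density.\<close>
      have "c = 1 / (2 powr (real n / 2) * pi powr (real n / 2))"
        by (simp add: c_def powr_minus_divide powr_mult)
      then have "c * (2 powr (real n / 2) * Gamma ((real n + \<beta>) / 2) / Gamma (\<beta> / 2) / a powr ((real n + \<beta>) / 2)) = cauchy_density n \<beta> x"
        by (simp add: cauchy_density_def a_def)
      then show ?thesis using c0 by (simp add: ennreal_mult'[symmetric])
    qed
    finally show "(\<integral>\<^sup>+t. indicator A x * (ennreal c * (ennreal (half_line_density \<beta> t) * (ennreal (P x t) * indicator {0<..} t))) \<partial>lborel) =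
      ennreal (cauchy_density n \<beta> x) * indicator A x" by (simp add: mult.commute)
  qed
  also have "\<dots> = emeasure (mm_measure (cauchy_space n \<beta>)) A"
    by (simp add: cauchy_space_def emeasure_density)
  finally show "emeasure (distr (gauss n \<Otimes>\<^sub>M half_line_measure \<beta>) ?L (\<lambda>(g, t). \<lambda>i\<in>{..<n}. t * g i)) A =
    emeasure (mm_measure (cauchy_space n \<beta>)) A" .
qed

section \<open>Concentration\<close>

abbreviation coupling :: "nat \<Rightarrow> real \<Rightarrow> ((nat \<Rightarrow> real) \<times> real) measure" where
  "coupling n \<beta> \<equiv> gauss n \<Otimes>\<^sub>M half_line_measure \<beta>"

lemma space_coupling: "space (coupling n \<beta>) = ({..<n} \<rightarrow>\<^sub>E UNIV) \<times> {0..}"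
  by (simp add: space_pair_measure space_gauss space_half_line_measure)

lemma prob_space_coupling:
  assumes "0 < \<beta>" shows "prob_space (coupling n \<beta>)"
proof -
  interpret gauss: prob_space "gauss n" by (rule prob_space_gauss)
  interpret nu: prob_space "half_line_measure \<beta>" by (rule prob_space_half_line_measure[OF assms])
  interpret pair_prob_space "gauss n" "half_line_measure \<beta>" ..
  show ?thesis by (rule P.prob_space_axioms)
qed

text \<open>Slots below \<open>n\<close> of the coded sequence hold the Gaussian coordinates and all
  other slots hold \<open>t\<close>, so decoding reads \<open>t\<close> from slot \<open>n\<close>.
  The \<open>max 0\<close> keeps the decoded value in the half line also for reals that code no
  point of the space.\<close>

lemma parameter_coupling:
  assumes "0 < \<beta>"
  shows "\<exists>\<theta>. \<theta> \<in> unit_lborel \<rightarrow>\<^sub>M coupling n \<beta> \<and> distr unit_lborel (coupling n \<beta>) \<theta> = coupling n \<beta>"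
proof (rule parameter_of_encoding[OF prob_space_coupling[OF assms],
      where J = "\<lambda>z. encode_seq (\<lambda>i. if i < n then fst z i else snd z)" and
        K = "\<lambda>r. (\<lambda>i\<in>{..<n}. decode_seq r i, max 0 (decode_seq r n))"])
  show "(\<lambda>z. encode_seq (\<lambda>i. if i < n then fst z i else snd z)) \<in> borel_measurable (coupling n \<beta>)"
  proof (rule measurable_encode_seq)
    fix i
    have 1: "(\<lambda>z. snd z) \<in> borel_measurable (coupling n \<beta>)"
      by (rule measurable_compose[OF measurable_snd borel_measurable_half_line_id])
    have 2: "(\<lambda>z. fst z i) \<in> borel_measurable (coupling n \<beta>)" if "i < n"
      by (rule measurable_compose[OF measurable_fst measurable_gauss_component[OF that]])
    show "(\<lambda>z. if i < n then fst z i else snd z) \<in> borel_measurable (coupling n \<beta>)"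
    proof (cases "i < n")
      case True
      show ?thesis unfolding if_P[OF True] by (rule 2[OF True])
    next
      case False
      show ?thesis unfolding if_not_P[OF False] by (rule 1)
    qed
  qed
  show "(\<lambda>r. (\<lambda>i\<in>{..<n}. decode_seq r i, max 0 (decode_seq r n))) \<in> borel \<rightarrow>\<^sub>M coupling n \<beta>"
  proof (rule measurable_Pair)
    show "(\<lambda>r. \<lambda>i\<in>{..<n}. decode_seq r i) \<in> borel \<rightarrow>\<^sub>M gauss n"
      unfolding measurable_cong_sets[OF refl sets_gauss]
      by (rule measurable_restrict) simp
    show "(\<lambda>r. max 0 (decode_seq r n)) \<in> borel \<rightarrow>\<^sub>M half_line_measure \<beta>"
      unfolding measurable_cong_sets[OF refl sets_half_line_measure]
    proof (rule measurable_restrict_space2)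
      show "(\<lambda>r. max 0 (decode_seq r n)) \<in> borel_measurable borel" by measurable
    qed simp
  qed
  fix z assume "z \<in> space (coupling n \<beta>)"
  then have z: "fst z \<in> {..<n} \<rightarrow>\<^sub>E UNIV" "0 \<le> snd z"
    unfolding space_coupling mem_Times_iff atLeast_iff by (rule conjunct1, elim conjunct2)
  have "(\<lambda>i\<in>{..<n}. decode_seq (encode_seq (\<lambda>i. if i < n then fst z i else snd z)) i) i = fst z i" for i
    using PiE_arb[OF z(1), of i] by (cases "i < n") simp_all
  then have "(\<lambda>i\<in>{..<n}. decode_seq (encode_seq (\<lambda>i. if i < n then fst z i else snd z)) i) = fst z"
    by (rule ext)
  moreover have "max 0 (decode_seq (encode_seq (\<lambda>i. if i < n then fst z i else snd z)) n) = snd z"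
    using z(2) by simp
  ultimately show "(\<lambda>i\<in>{..<n}. decode_seq (encode_seq (\<lambda>i. if i < n then fst z i else snd z)) i,
      max 0 (decode_seq (encode_seq (\<lambda>i. if i < n then fst z i else snd z)) n)) = z"
    by simp
qed

lemma distr_coupling_snd:
  assumes "0 < \<beta>"
  shows "distr (coupling n \<beta>) (half_line_measure \<beta>) snd = half_line_measure \<beta>"
proof (rule measure_eqI)
  interpret gauss: prob_space "gauss n" by (rule prob_space_gauss)
  interpret nu: prob_space "half_line_measure \<beta>" by (rule prob_space_half_line_measure[OF assms])
  fix A assume "A \<in> sets (distr (coupling n \<beta>) (half_line_measure \<beta>) snd)"
  then have A: "A \<in> sets (half_line_measure \<beta>)" by simp
  have "snd -` A \<inter> space (coupling n \<beta>) = space (gauss n) \<times> A"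
    using sets.sets_into_space[OF A] by (auto simp: space_pair_measure)
  then show "emeasure (distr (coupling n \<beta>) (half_line_measure \<beta>) snd) A = emeasure (half_line_measure \<beta>) A"
    using A by (simp add: emeasure_distr nu.emeasure_pair_measure_Times gauss.emeasure_space_1)
qed simp

section \<open>Deviation in probability, uniformly over Lipschitz functions\<close>

lemma ky_fan_leI:
  assumes "0 \<le> \<epsilon>" "measure unit_lborel {s \<in> {0..1}. \<bar>g s - h s\<bar> > \<epsilon>} \<le> \<epsilon>"
  shows "ky_fan g h \<le> \<epsilon>"
  unfolding ky_fan_def by (rule cInf_lower) (use assms in \<open>auto intro!: bdd_belowI[of _ 0]\<close>)

text \<open>Chebyshev's bound at threshold \<epsilon> for a conditional second moment of at most
  \<open>4 * t^2 / n\<close>, averaged over \<open>t\<close>. The cap at 1 keeps the integrand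
  integrable and supplies the constant majorant for dominated convergence.\<close>

definition deviation_bound :: "real \<Rightarrow> nat \<Rightarrow> real \<Rightarrow> real" where
  "deviation_bound \<beta> n \<epsilon> = (\<integral>t. min 1 (4 * t\<^sup>2 / (n * \<epsilon>\<^sup>2)) \<partial>half_line_measure \<beta>)"

lemma deviation_bound_measurable: "(\<lambda>t. min 1 (4 * t\<^sup>2 / (real n * \<epsilon>\<^sup>2))) \<in> borel_measurable (half_line_measure \<beta>)"
  by (rule measurable_compose[OF borel_measurable_half_line_id]) measurable

lemma deviation_bound_integrable:
  assumes "0 < \<beta>"
  shows "integrable (half_line_measure \<beta>) (\<lambda>t. min 1 (4 * t\<^sup>2 / (real n * \<epsilon>\<^sup>2)))"
proof -
  interpret nu: prob_space "half_line_measure \<beta>" by (rule prob_space_half_line_measure[OF assms])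
  show ?thesis by (rule nu.integrable_const_bound[where B=1]) (auto intro: deviation_bound_measurable)
qed

lemma deviation_bound_tendsto_0:
  assumes "0 < \<beta>" and \<epsilon>: "0 < \<epsilon>"
  shows "(\<lambda>k. deviation_bound \<beta> (Suc k) \<epsilon>) \<longlonglongrightarrow> 0"
proof -
  interpret nu: prob_space "half_line_measure \<beta>" by (rule prob_space_half_line_measure) fact
  have lim: "(\<lambda>k. min 1 (4 * t\<^sup>2 / (real (Suc k) * \<epsilon>\<^sup>2))) \<longlonglongrightarrow> 0" for t :: real
  proof -
    have "(\<lambda>k. min 1 ((4 * t\<^sup>2 / \<epsilon>\<^sup>2) * inverse (real (Suc k)))) \<longlonglongrightarrow> min 1 ((4 * t\<^sup>2 / \<epsilon>\<^sup>2) * 0)"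
      by (intro tendsto_intros LIMSEQ_inverse_real_of_nat)
    then show ?thesis by (simp add: field_simps)
  qed
  have "(\<lambda>k. deviation_bound \<beta> (Suc k) \<epsilon>) \<longlonglongrightarrow> (\<integral>t. 0 \<partial>half_line_measure \<beta>)"
    unfolding deviation_bound_def
    by (rule integral_dominated_convergence[where w="\<lambda>_. 1"]) (use lim in \<open>auto simp del: of_nat_Suc intro: deviation_bound_measurable\<close>)
  then show ?thesis by simp
qed

text \<open>Markov's inequality for the square of \<open>D\<close> on each slice of fixed
  \<open>t\<close>, followed by integration over \<open>t\<close>. The resulting bound involves
  \<open>D\<close> only through the hypothesis on its conditional second moment, whence the
  uniformity.\<close>

lemma coupling_deviation:
  assumes \<beta>: "0 < \<beta>" and n: "0 < n" and \<epsilon>: "0 < \<epsilon>"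
    and D[measurable]: "D \<in> borel_measurable (coupling n \<beta>)"
    and le: "\<And>t. 0 \<le> t \<Longrightarrow> (\<integral>\<^sup>+g. ennreal ((D (g, t))\<^sup>2) \<partial>gauss n) \<le> ennreal (4 * t\<^sup>2 / n)"
  shows "measure (coupling n \<beta>) {z \<in> space (coupling n \<beta>). \<epsilon> < \<bar>D z\<bar>} \<le> deviation_bound \<beta> n \<epsilon>"
proof -
  interpret gauss: prob_space "gauss n" by (rule prob_space_gauss)
  interpret nu: prob_space "half_line_measure \<beta>" by (rule prob_space_half_line_measure[OF \<beta>])
  interpret pair_prob_space "gauss n" "half_line_measure \<beta>" ..
  define A where "A = {z \<in> space (coupling n \<beta>). \<epsilon> < \<bar>D z\<bar>}"
  have A: "A \<in> sets (coupling n \<beta>)" unfolding A_def by measurable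
  have bound_nonneg: "0 \<le> deviation_bound \<beta> n \<epsilon>" unfolding deviation_bound_def by (intro integral_nonneg_AE AE_I2) simp
  have "emeasure (coupling n \<beta>) A = (\<integral>\<^sup>+t. emeasure (gauss n) ((\<lambda>g. (g, t)) -` A) \<partial>half_line_measure \<beta>)"
    by (rule emeasure_pair_measure_alt2[OF A])
  also have "\<dots> \<le> (\<integral>\<^sup>+t. ennreal (min 1 (4 * t\<^sup>2 / (real n * \<epsilon>\<^sup>2))) \<partial>half_line_measure \<beta>)"
  proof (rule nn_integral_mono)
    fix t assume t: "t \<in> space (half_line_measure \<beta>)"
    then have t0: "0 \<le> t" by (simp add: space_half_line_measure)
    have Dt[measurable]: "(\<lambda>g. D (g, t)) \<in> borel_measurable (gauss n)"
      by (rule measurable_compose[OF measurable_Pair2'[OF t] D])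
    have "(\<lambda>g. (g, t)) -` A = {g \<in> space (gauss n). \<epsilon> < \<bar>D (g, t)\<bar>}"
      using t by (auto simp: A_def space_pair_measure)
    also have "\<dots> \<subseteq> {g \<in> space (gauss n). 1 \<le> ennreal (1 / \<epsilon>\<^sup>2) * ennreal ((D (g, t))\<^sup>2)}"
    proof safe
      fix g assume "\<epsilon> < \<bar>D (g, t)\<bar>"
      then have "\<epsilon>\<^sup>2 \<le> \<bar>D (g, t)\<bar>\<^sup>2" using \<epsilon> by (intro power_mono) auto
      then have "1 \<le> 1 / \<epsilon>\<^sup>2 * (D (g, t))\<^sup>2" using \<epsilon> by (simp add: field_simps)
      then show "1 \<le> ennreal (1 / \<epsilon>\<^sup>2) * ennreal ((D (g, t))\<^sup>2)"
        by (simp add: ennreal_mult[symmetric])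
    qed
    finally have "emeasure (gauss n) ((\<lambda>g. (g, t)) -` A) \<le>
      emeasure (gauss n) {g \<in> space (gauss n). 1 \<le> ennreal (1 / \<epsilon>\<^sup>2) * ennreal ((D (g, t))\<^sup>2)}"
      by (rule emeasure_mono) measurable
    also have "\<dots> \<le> ennreal (1 / \<epsilon>\<^sup>2) * (\<integral>\<^sup>+g. ennreal ((D (g, t))\<^sup>2) * indicator (space (gauss n)) g \<partial>gauss n)"
      by (rule nn_integral_Markov_inequality) auto
    also have "(\<integral>\<^sup>+g. ennreal ((D (g, t))\<^sup>2) * indicator (space (gauss n)) g \<partial>gauss n) = (\<integral>\<^sup>+g. ennreal ((D (g, t))\<^sup>2) \<partial>gauss n)"
      by (intro nn_integral_cong) simp
    also have "ennreal (1 / \<epsilon>\<^sup>2) * \<dots> \<le> ennreal (1 / \<epsilon>\<^sup>2) * ennreal (4 * t\<^sup>2 / n)"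
      by (intro mult_left_mono le t0) simp
    also have "\<dots> = ennreal (4 * t\<^sup>2 / (real n * \<epsilon>\<^sup>2))"
      by (simp add: ennreal_mult[symmetric] mult.commute)
    finally have "emeasure (gauss n) ((\<lambda>g. (g, t)) -` A) \<le> ennreal (4 * t\<^sup>2 / (real n * \<epsilon>\<^sup>2))" .
    moreover have "emeasure (gauss n) ((\<lambda>g. (g, t)) -` A) \<le> ennreal 1"
      using gauss.emeasure_le_1 by simp
    ultimately show "emeasure (gauss n) ((\<lambda>g. (g, t)) -` A) \<le> ennreal (min 1 (4 * t\<^sup>2 / (real n * \<epsilon>\<^sup>2)))"
      by (simp add: min_def)
  qed
  also have "\<dots> = ennreal (deviation_bound \<beta> n \<epsilon>)"
    unfolding deviation_bound_def by (intro nn_integral_eq_integral deviation_bound_integrable[OF \<beta>] AE_I2) simp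
  finally show ?thesis
    unfolding A_def[symmetric] using bound_nonneg by (simp add: P.emeasure_eq_measure)
qed

section \<open>Approximating Lipschitz functions in both directions\<close>

lemma half_line_Lip1_measurable:
  assumes "h \<in> Lip1 (half_line_space \<beta>)"
  shows "h \<in> borel_measurable (half_line_measure \<beta>)"
proof -
  have "1-lipschitz_on {0..} h"
    using assms by (intro lipschitz_onI) (auto simp: Lip1_def half_line_space_def dist_real_def)
  then have "continuous_on {0..} h" by (rule lipschitz_on_continuous_on)
  then show ?thesis
    by (subst measurable_cong_sets[OF sets_half_line_measure refl]) (rule borel_measurable_continuous_on_restrict)
qed

definition scaled_cauchy_space :: "nat \<Rightarrow> real \<Rightarrow> (nat \<Rightarrow> real) mm" where
  "scaled_cauchy_space n \<beta> = mm_scale (1 / sqrt n) (cauchy_space n \<beta>)"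

lemma scaled_cauchy_space_simps:
  "mm_carrier (scaled_cauchy_space n \<beta>) = {..<n} \<rightarrow>\<^sub>E UNIV" "mm_dist (scaled_cauchy_space n \<beta>) = (\<lambda>x y. 1 / sqrt n * L2_set (\<lambda>i. x i - y i) {..<n})"
  "mm_measure (scaled_cauchy_space n \<beta>) = mm_measure (cauchy_space n \<beta>)"
  by (simp_all add: scaled_cauchy_space_def mm_scale_def cauchy_space_def)

context
  fixes \<beta> :: real and n :: nat
  assumes \<beta>: "0 < \<beta>" and n: "0 < n"
begin

abbreviation (input) "X \<equiv> scaled_cauchy_space n \<beta>"

lemma mm_space_scaled_cauchy_space: "mm_space X"
proof (rule mm_space_L2[of "1 / sqrt n"])
  interpret prob_space "coupling n \<beta>" by (rule prob_space_coupling[OF \<beta>])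
  show "prob_space (mm_measure X)"
    unfolding scaled_cauchy_space_simps cauchy_measure_eq_distr[OF \<beta>, symmetric] by (rule prob_space_distr) measurable
qed (use n in \<open>simp_all add: scaled_cauchy_space_simps sets_cauchy_measure\<close>)

lemma scaled_Lip1_measurable:
  assumes "f \<in> Lip1 X" shows "f \<in> borel_measurable (\<Pi>\<^sub>M i\<in>{..<n}. lborel)"
  by (rule Lipschitz_L2_measurable[of "1 / sqrt n"]) (use n assms in \<open>auto simp: Lip1_def scaled_cauchy_space_simps\<close>)

text \<open>For fixed \<open>t\<close> the function \<open>g \<mapsto> f (t g)\<close> is Lipschitz
  with constant \<open>t / sqrt n\<close>, and \<open>D\<close> is its deviation from its mean, so
  the variance bound gives \<open>2 * t^2 / n\<close>. This is weakened to
  \<open>4 * t^2 / n\<close> to share one bound with the opposite direction.\<close>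

lemma scaled_Lip1_approx:
  assumes f: "f \<in> Lip1 X"
  obtains h D where "h \<in> Lip1 (half_line_space \<beta>)" "D = (\<lambda>(g, t). f (\<lambda>i\<in>{..<n}. t * g i) - h t)"
    "D \<in> borel_measurable (coupling n \<beta>)"
    "\<And>t. 0 \<le> t \<Longrightarrow> (\<integral>\<^sup>+g. ennreal ((D (g, t))\<^sup>2) \<partial>gauss n) \<le> ennreal (4 * t\<^sup>2 / n)"
proof -
  interpret gauss: prob_space "gauss n" by (rule prob_space_gauss)
  define F where "F t g = f (\<lambda>i\<in>{..<n}. t * g i)" for t and g :: "nat \<Rightarrow> real"
  define h where "h t = (\<integral>g. F t g \<partial>gauss n)" for t
  define D where "D = (\<lambda>(g, t). f (\<lambda>i\<in>{..<n}. t * g i) - h t)"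
  have lip: "\<bar>f x - f y\<bar> \<le> 1 / sqrt n * L2_set (\<lambda>i. x i - y i) {..<n}"
    if "x \<in> {..<n} \<rightarrow>\<^sub>E UNIV" "y \<in> {..<n} \<rightarrow>\<^sub>E UNIV" for x y
    using f that by (simp add: Lip1_def scaled_cauchy_space_simps)
  note [measurable] = scaled_Lip1_measurable[OF f]
  have scale_L2: "L2_set (\<lambda>i. r * x i) {..<n} = \<bar>r\<bar> * L2_set x {..<n}" for r x
    by (simp add: L2_set_def power_mult_distrib sum_distrib_left[symmetric] real_sqrt_mult)
  have F[measurable]: "F t \<in> borel_measurable (\<Pi>\<^sub>M i\<in>{..<n}. lborel)" for t
    unfolding F_def
    by (rule measurable_compose[OF _ scaled_Lip1_measurable[OF f]]) (intro measurable_restrict, measurable)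
  have Flip: "\<bar>F t x - F t y\<bar> \<le> (t / sqrt n) * L2_set (\<lambda>i. x i - y i) {..<n}"
    if t: "0 \<le> t" for t x y
  proof -
    have "\<bar>F t x - F t y\<bar> \<le> 1 / sqrt n * L2_set (\<lambda>i. (\<lambda>i\<in>{..<n}. t * x i) i - (\<lambda>i\<in>{..<n}. t * y i) i) {..<n}"
      unfolding F_def by (rule lip) auto
    also have "L2_set (\<lambda>i. (\<lambda>i\<in>{..<n}. t * x i) i - (\<lambda>i\<in>{..<n}. t * y i) i) {..<n} = L2_set (\<lambda>i. t * (x i - y i)) {..<n}"
      by (intro L2_set_cong) (auto simp: algebra_simps)
    finally show ?thesis using t by (simp add: scale_L2)
  qed
  have Fint: "integrable (gauss n) (F t)" if "0 \<le> t" for t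
    by (rule gauss_Lipschitz_integrable(1)[OF F Flip[OF that]])
  have "h \<in> Lip1 (half_line_space \<beta>)"
    unfolding Lip1_def
  proof (intro CollectI ballI)
    fix s t assume "s \<in> mm_carrier (half_line_space \<beta>)" "t \<in> mm_carrier (half_line_space \<beta>)"
    then have st: "0 \<le> s" "0 \<le> t" by (auto simp: half_line_space_def)
    have diff: "\<bar>F s g - F t g\<bar> \<le> \<bar>s - t\<bar> / sqrt n * L2_set g {..<n}" for g
    proof -
      have "\<bar>F s g - F t g\<bar> \<le> 1 / sqrt n * L2_set (\<lambda>i. (\<lambda>i\<in>{..<n}. s * g i) i - (\<lambda>i\<in>{..<n}. t * g i) i) {..<n}"
        unfolding F_def by (rule lip) auto
      also have "L2_set (\<lambda>i. (\<lambda>i\<in>{..<n}. s * g i) i - (\<lambda>i\<in>{..<n}. t * g i) i) {..<n} = L2_set (\<lambda>i. (s - t) * g i) {..<n}"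
        by (intro L2_set_cong) (auto simp: algebra_simps)
      finally show ?thesis by (simp add: scale_L2)
    qed
    have "\<bar>h s - h t\<bar> = \<bar>\<integral>g. F s g - F t g \<partial>gauss n\<bar>"
      unfolding h_def using Fint st by simp
    also have "\<dots> \<le> (\<integral>g. \<bar>F s g - F t g\<bar> \<partial>gauss n)"
      by (rule integral_abs_bound)
    also have "\<dots> \<le> (\<integral>g. \<bar>s - t\<bar> / sqrt n * L2_set g {..<n} \<partial>gauss n)"
      by (intro integral_mono diff integrable_abs Bochner_Integration.integrable_diff Fint st integrable_mult_right gauss_norm_mean(1))
    also have "\<dots> = \<bar>s - t\<bar> / sqrt n * (\<integral>g. L2_set g {..<n} \<partial>gauss n)" by simp
    also have "\<dots> \<le> \<bar>s - t\<bar> / sqrt n * sqrt n"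
      by (intro mult_left_mono gauss_norm_mean(3)) simp
    also have "\<dots> = \<bar>s - t\<bar>" using n by simp
    finally show "\<bar>h s - h t\<bar> \<le> mm_dist (half_line_space \<beta>) s t"
      by (simp add: half_line_space_def)
  qed
  moreover have "D \<in> borel_measurable (coupling n \<beta>)"
  proof -
    have "(\<lambda>z. f (case z of (g, t) \<Rightarrow> \<lambda>i\<in>{..<n}. t * g i)) \<in> borel_measurable (coupling n \<beta>)"
      by (rule measurable_compose[OF measurable_scale_pair scaled_Lip1_measurable[OF f]])
    moreover have "(\<lambda>z. h (snd z)) \<in> borel_measurable (coupling n \<beta>)"
      by (rule measurable_compose[OF measurable_snd half_line_Lip1_measurable]) fact
    ultimately show ?thesis unfolding D_def by (simp add: split_beta)
  qed
  moreover have "(\<integral>\<^sup>+g. ennreal ((D (g, t))\<^sup>2) \<partial>gauss n) \<le> ennreal (4 * t\<^sup>2 / n)" if t: "0 \<le> t" for t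
  proof (cases "t = 0")
    case True
    \<comment> \<open>The variance bound asks for a positive Lipschitz constant, which excludes
      \<open>t = 0\<close>; there \<open>f\<close> is evaluated at the origin only and equals its
      mean.\<close>
    have "D (g, t) = 0" for g
      by (simp add: D_def h_def F_def True gauss.prob_space)
    then show ?thesis by simp
  next
    case False
    have "integrable (gauss n) (\<lambda>g. (F t g - h t)\<^sup>2)"
      by (rule gauss_Lipschitz_integrable(2)[where L="t / sqrt n"]) (use Flip[OF t] in auto)
    then have "(\<integral>\<^sup>+g. ennreal ((D (g, t))\<^sup>2) \<partial>gauss n) = ennreal (\<integral>g. (F t g - h t)\<^sup>2 \<partial>gauss n)"
      by (simp add: D_def F_def[symmetric] nn_integral_eq_integral)
    also have "\<dots> \<le> ennreal (2 * (t / sqrt n)\<^sup>2)"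
      unfolding h_def by (intro ennreal_leI gauss_variance_Lipschitz Flip t F) (use False t n in simp)
    also have "\<dots> \<le> ennreal (4 * t\<^sup>2 / n)"
      using n by (intro ennreal_leI) (simp add: power_divide divide_right_mono)
    finally show ?thesis .
  qed
  ultimately show ?thesis using that D_def by blast
qed

text \<open>As \<open>h\<close> is 1-Lipschitz, \<open>\<bar>D (g, t)\<bar>\<close> is at most
  \<open>t / sqrt n\<close> times the deviation of the norm of \<open>g\<close> from
  \<open>sqrt n\<close>. The second moment of that deviation is at most 4, which is the origin of
  the constant in the bound.\<close>

lemma half_line_Lip1_approx:
  assumes h: "h \<in> Lip1 (half_line_space \<beta>)"
  obtains f D where "f \<in> Lip1 X" "D = (\<lambda>(g, t). f (\<lambda>i\<in>{..<n}. t * g i) - h t)"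
    "D \<in> borel_measurable (coupling n \<beta>)"
    "\<And>t. 0 \<le> t \<Longrightarrow> (\<integral>\<^sup>+g. ennreal ((D (g, t))\<^sup>2) \<partial>gauss n) \<le> ennreal (4 * t\<^sup>2 / n)"
proof -
  define f where "f x = h (1 / sqrt n * L2_set x {..<n})" for x
  define D where "D = (\<lambda>(g, t). f (\<lambda>i\<in>{..<n}. t * g i) - h t)"
  have lip: "\<bar>h s - h t\<bar> \<le> \<bar>s - t\<bar>" if "0 \<le> s" "0 \<le> t" for s t
    using h that by (simp add: Lip1_def half_line_space_def)
  have "f \<in> Lip1 X"
    unfolding Lip1_def scaled_cauchy_space_simps
  proof (intro CollectI ballI)
    fix x y :: "nat \<Rightarrow> real"
    have "\<bar>f x - f y\<bar> \<le> \<bar>1 / sqrt n * L2_set x {..<n} - 1 / sqrt n * L2_set y {..<n}\<bar>"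
      unfolding f_def by (rule lip) auto
    also have "\<dots> = 1 / sqrt n * \<bar>L2_set x {..<n} - L2_set y {..<n}\<bar>"
      by (simp add: diff_divide_distrib[symmetric])
    also have "\<dots> \<le> 1 / sqrt n * L2_set (\<lambda>i. x i - y i) {..<n}"
      by (intro mult_left_mono L2_set_triangle_diff) simp
    finally show "\<bar>f x - f y\<bar> \<le> 1 / sqrt n * L2_set (\<lambda>i. x i - y i) {..<n}" .
  qed
  moreover have "D \<in> borel_measurable (coupling n \<beta>)"
  proof -
    have "(\<lambda>z. f (case z of (g, t) \<Rightarrow> \<lambda>i\<in>{..<n}. t * g i)) \<in> borel_measurable (coupling n \<beta>)"
      by (rule measurable_compose[OF measurable_scale_pair scaled_Lip1_measurable]) fact
    moreover have "(\<lambda>z. h (snd z)) \<in> borel_measurable (coupling n \<beta>)"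
      by (rule measurable_compose[OF measurable_snd half_line_Lip1_measurable[OF h]])
    ultimately show ?thesis unfolding D_def by (simp add: split_beta)
  qed
  moreover have "(\<integral>\<^sup>+g. ennreal ((D (g, t))\<^sup>2) \<partial>gauss n) \<le> ennreal (4 * t\<^sup>2 / n)" if t: "0 \<le> t" for t
  proof -
    have bound: "(D (g, t))\<^sup>2 \<le> t\<^sup>2 / n * (L2_set g {..<n} - sqrt n)\<^sup>2" for g
    proof -
      have "L2_set (\<lambda>i\<in>{..<n}. t * g i) {..<n} = L2_set (\<lambda>i. t * g i) {..<n}"
        by (intro L2_set_cong) auto
      also have "\<dots> = t * L2_set g {..<n}"
        using t by (simp add: L2_set_def power_mult_distrib sum_distrib_left[symmetric] real_sqrt_mult)
      finally have "D (g, t) = h (1 / sqrt n * (t * L2_set g {..<n})) - h t"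
        by (simp add: D_def f_def)
      then have "\<bar>D (g, t)\<bar> \<le> \<bar>1 / sqrt n * (t * L2_set g {..<n}) - t\<bar>"
        using lip[of "1 / sqrt n * (t * L2_set g {..<n})" t] t by simp
      also have "1 / sqrt n * (t * L2_set g {..<n}) - t = t / sqrt n * (L2_set g {..<n} - sqrt n)"
        using n by (simp add: field_simps)
      finally have "\<bar>D (g, t)\<bar>\<^sup>2 \<le> \<bar>t / sqrt n * (L2_set g {..<n} - sqrt n)\<bar>\<^sup>2"
        by (intro power_mono) auto
      then show ?thesis by (simp only: power2_abs power_mult_distrib power_divide) simp
    qed
    have "(\<integral>\<^sup>+g. ennreal ((D (g, t))\<^sup>2) \<partial>gauss n) \<le> (\<integral>\<^sup>+g. ennreal (t\<^sup>2 / n * (L2_set g {..<n} - sqrt n)\<^sup>2) \<partial>gauss n)"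
      by (intro nn_integral_mono ennreal_leI bound)
    also have "\<dots> = ennreal (\<integral>g. t\<^sup>2 / n * (L2_set g {..<n} - sqrt n)\<^sup>2 \<partial>gauss n)"
      by (intro nn_integral_eq_integral integrable_mult_right gauss_norm_deviation(1) AE_I2) simp
    also have "\<dots> \<le> ennreal (t\<^sup>2 / n * 4)"
    proof (rule ennreal_leI)
      show "(\<integral>g. t\<^sup>2 / n * (L2_set g {..<n} - sqrt n)\<^sup>2 \<partial>gauss n) \<le> t\<^sup>2 / n * 4"
        using mult_left_mono[OF gauss_norm_deviation(2)[of n], of "t\<^sup>2 / n"] by simp
    qed
    finally show ?thesis by (simp add: mult.commute)
  qed
  ultimately show ?thesis using that D_def by blast
qed

text \<open>Both parameters factor through the same \<open>\<theta>\<close>, so the two pulled-back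
  functions differ by \<open>D \<circ> \<theta>\<close>, and the Ky Fan distance becomes a deviation
  probability under the coupling. The choice of \<open>\<theta>\<close> precedes that of the
  Lipschitz functions, so the estimate passes to the Hausdorff distance.\<close>

lemma d_conc_scaled_cauchy_space_le:
  assumes \<epsilon>: "0 < \<epsilon>" and deviation_bound: "deviation_bound \<beta> n \<epsilon> \<le> \<epsilon>"
  shows "d_conc X (half_line_space \<beta>) \<le> ennreal \<epsilon>"
proof -
  obtain \<theta> where \<theta>[measurable]: "\<theta> \<in> unit_lborel \<rightarrow>\<^sub>M coupling n \<beta>"
    and dist: "distr unit_lborel (coupling n \<beta>) \<theta> = coupling n \<beta>"
    using parameter_coupling[OF \<beta>] by blast
  define sc where "sc = (\<lambda>(g :: nat \<Rightarrow> real, t). \<lambda>i\<in>{..<n}. t * g i)"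
  have sc[measurable]: "sc \<in> coupling n \<beta> \<rightarrow>\<^sub>M mm_measure X"
    unfolding sc_def measurable_cong_sets[OF refl sets_cauchy_measure] scaled_cauchy_space_simps by (rule measurable_scale_pair)
  have "distr unit_lborel (mm_measure X) (sc \<circ> \<theta>) = distr (coupling n \<beta>) (mm_measure X) sc"
    by (subst distr_distr[symmetric, OF sc \<theta>]) (simp add: dist)
  also have "\<dots> = distr (coupling n \<beta>) (\<Pi>\<^sub>M i\<in>{..<n}. lborel) sc"
    by (rule distr_cong) (simp_all add: scaled_cauchy_space_simps sets_cauchy_measure)
  also have "\<dots> = mm_measure X"
    unfolding sc_def scaled_cauchy_space_simps by (rule cauchy_measure_eq_distr[OF \<beta>])
  finally have \<phi>: "sc \<circ> \<theta> \<in> parameters X"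
    unfolding parameters_def using measurable_comp[OF \<theta> sc] by simp
  have "distr unit_lborel (half_line_measure \<beta>) (snd \<circ> \<theta>) = half_line_measure \<beta>"
    by (subst distr_distr[symmetric, OF measurable_snd \<theta>]) (simp add: dist distr_coupling_snd[OF \<beta>])
  then have \<psi>: "snd \<circ> \<theta> \<in> parameters (half_line_space \<beta>)"
    unfolding parameters_def using measurable_comp[OF \<theta> measurable_snd] by simp
  \<comment> \<open>One estimate for a pair \<open>(f, h)\<close> serves both halves of the
    Hausdorff distance: either function may be the given one and the other its
    approximation.\<close>
  have ky: "ky_fan (f \<circ> (sc \<circ> \<theta>)) (h \<circ> (snd \<circ> \<theta>)) \<le> \<epsilon>"
    if D: "D = (\<lambda>(g, t). f (\<lambda>i\<in>{..<n}. t * g i) - h t)" and Dm: "D \<in> borel_measurable (coupling n \<beta>)"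
      and le: "\<And>t. 0 \<le> t \<Longrightarrow> (\<integral>\<^sup>+g. ennreal ((D (g, t))\<^sup>2) \<partial>gauss n) \<le> ennreal (4 * t\<^sup>2 / n)" for f h D
  proof (rule ky_fan_leI)
    let ?A = "{z \<in> space (coupling n \<beta>). \<epsilon> < \<bar>D z\<bar>}"
    have A: "?A \<in> sets (coupling n \<beta>)" using Dm by measurable
    have "{s \<in> {0..1}. \<bar>(f \<circ> (sc \<circ> \<theta>)) s - (h \<circ> (snd \<circ> \<theta>)) s\<bar> > \<epsilon>} = \<theta> -` ?A \<inter> space unit_lborel"
      using measurable_space[OF \<theta>] by (auto simp: D sc_def split_beta space_restrict_space)
    also have "measure unit_lborel \<dots> = measure (distr unit_lborel (coupling n \<beta>) \<theta>) ?A"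
      by (rule measure_distr[OF \<theta> A, symmetric])
    also have "\<dots> \<le> deviation_bound \<beta> n \<epsilon>"
      unfolding dist by (rule coupling_deviation[OF \<beta> n \<epsilon> Dm le])
    finally show "measure unit_lborel {s \<in> {0..1}. \<bar>(f \<circ> (sc \<circ> \<theta>)) s - (h \<circ> (snd \<circ> \<theta>)) s\<bar> > \<epsilon>} \<le> \<epsilon>"
      using deviation_bound by simp
  qed (use \<epsilon> in simp)
  have "d_conc X (half_line_space \<beta>) \<le>
      ky_fan_hausdorff (pullback_Lip1 (sc \<circ> \<theta>) X) (pullback_Lip1 (snd \<circ> \<theta>) (half_line_space \<beta>))"
    unfolding d_conc_def by (rule INF_lower2[OF \<phi>], rule INF_lower2[OF \<psi>], rule order.refl)
  also have "\<dots> \<le> ennreal \<epsilon>"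
    unfolding ky_fan_hausdorff_def
  proof (intro max.boundedI SUP_least)
    fix u assume "u \<in> pullback_Lip1 (sc \<circ> \<theta>) X"
    then obtain f where f: "f \<in> Lip1 X" "u = f \<circ> (sc \<circ> \<theta>)" by (auto simp: pullback_Lip1_def)
    have "\<exists>h\<in>Lip1 (half_line_space \<beta>). ky_fan (f \<circ> (sc \<circ> \<theta>)) (h \<circ> (snd \<circ> \<theta>)) \<le> \<epsilon>"
      by (rule scaled_Lip1_approx[OF f(1)]) (rule bexI[rotated], assumption, rule ky, assumption+)
    then obtain h where h: "h \<in> Lip1 (half_line_space \<beta>)" "ky_fan (f \<circ> (sc \<circ> \<theta>)) (h \<circ> (snd \<circ> \<theta>)) \<le> \<epsilon>"
      by blast
    from h(1) have "h \<circ> (snd \<circ> \<theta>) \<in> pullback_Lip1 (snd \<circ> \<theta>) (half_line_space \<beta>)"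
      unfolding pullback_Lip1_def by (rule imageI)
    from INF_lower2[OF this, of "\<lambda>v. ennreal (ky_fan u v)"] ennreal_leI[OF h(2)] show "(INF v\<in>pullback_Lip1 (snd \<circ> \<theta>) (half_line_space \<beta>). ennreal (ky_fan u v)) \<le> ennreal \<epsilon>"
      unfolding f(2) by blast
  next
    fix v assume "v \<in> pullback_Lip1 (snd \<circ> \<theta>) (half_line_space \<beta>)"
    then obtain h where h: "h \<in> Lip1 (half_line_space \<beta>)" "v = h \<circ> (snd \<circ> \<theta>)" by (auto simp: pullback_Lip1_def)
    have "\<exists>f\<in>Lip1 X. ky_fan (f \<circ> (sc \<circ> \<theta>)) (h \<circ> (snd \<circ> \<theta>)) \<le> \<epsilon>"
      by (rule half_line_Lip1_approx[OF h(1)]) (rule bexI[rotated], assumption, rule ky, assumption+)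
    then obtain f where f: "f \<in> Lip1 X" "ky_fan (f \<circ> (sc \<circ> \<theta>)) (h \<circ> (snd \<circ> \<theta>)) \<le> \<epsilon>"
      by blast
    from f(1) have "f \<circ> (sc \<circ> \<theta>) \<in> pullback_Lip1 (sc \<circ> \<theta>) X"
      unfolding pullback_Lip1_def by (rule imageI)
    from INF_lower2[OF this, of "\<lambda>u. ennreal (ky_fan u v)"] ennreal_leI[OF f(2)] show "(INF u\<in>pullback_Lip1 (sc \<circ> \<theta>) X. ennreal (ky_fan u v)) \<le> ennreal \<epsilon>"
      unfolding h(2) by blast
  qed
  finally show ?thesis .
qed

end

theorem theorem1p4:
  fixes \<beta> :: real
  assumes "\<beta> > 0"
  shows "concentrates_to
           (\<lambda>k. mm_scale (1 / sqrt (real (Suc k))) (cauchy_space (Suc k) \<beta>))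
           (half_line_space \<beta>)"
  unfolding concentrates_to_def
proof (intro conjI allI)
  show "mm_space (mm_scale (1 / sqrt (real (Suc k))) (cauchy_space (Suc k) \<beta>))" for k
    using mm_space_scaled_cauchy_space[OF assms, of "Suc k"] by (simp add: scaled_cauchy_space_def)
  show "mm_space (half_line_space \<beta>)"
    by (intro mm_space_half_line prob_space_half_line_measure assms)
  show "(\<lambda>k. d_conc (mm_scale (1 / sqrt (real (Suc k))) (cauchy_space (Suc k) \<beta>)) (half_line_space \<beta>)) \<longlonglongrightarrow> 0"
  proof (rule order_tendstoI)
    fix a :: ennreal assume "0 < a"
    \<comment> \<open>An intermediate value is finite even if \<open>a\<close> is infinite, hence a
      real \<epsilon>; it also turns the non-strict bound by \<epsilon> into a strict one by
      \<open>a\<close>.\<close>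
    then obtain y where y: "0 < y" "y < a" using dense by blast
    then obtain \<epsilon> where \<epsilon>: "y = ennreal \<epsilon>" "0 < \<epsilon>"
      by (cases y) auto
    have "\<forall>\<^sub>F k in sequentially. deviation_bound \<beta> (Suc k) \<epsilon> < \<epsilon>"
      by (rule order_tendstoD(2)[OF deviation_bound_tendsto_0[OF assms \<epsilon>(2)] \<epsilon>(2)])
    then show "\<forall>\<^sub>F k in sequentially. d_conc (mm_scale (1 / sqrt (real (Suc k))) (cauchy_space (Suc k) \<beta>)) (half_line_space \<beta>) < a"
    proof eventually_elim
      case (elim k)
      then have "d_conc (mm_scale (1 / sqrt (real (Suc k))) (cauchy_space (Suc k) \<beta>)) (half_line_space \<beta>) \<le> ennreal \<epsilon>"
        using d_conc_scaled_cauchy_space_le[OF assms, of "Suc k" \<epsilon>] \<epsilon> by (simp add: scaled_cauchy_space_def)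
      then show ?case using y \<epsilon> by (simp add: le_less_trans)
    qed
  qed simp
qed

end
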